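(* There exist constants $\alpha>0$ and $K>0$ such that for every $n\in\mathbb{N}$ there exists an $n$-element set $A\subset\mathbb{R}^3$ in general position with $\Delta(A)\le \alpha n^{1/3}$ in which every subset in convex position has at most $K n^{1/2}$ points.
   Context: A finite set of points in $\mathbb{R}^3$ is in general position if any $4$ or fewer of its points are affinely independent, and in convex position if no point lies in the convex hull of the others. The spread $\Delta(A)$ of a finite set $A$ is the ratio of the maximum pairwise Euclidean distance to the minimum pairwise Euclidean distance among points of $A$. *)

theory Defs
  imports "HOL-Analysis.Analysis"
begin

definition general_position :: "(real ^ 3) set \<Rightarrow> bool" where
  "general_position A \<longleftrightarrow>
    finite A \<and> (\<forall>B. B \<subseteq> A \<and> card B \<le> 4 \<longrightarrow> \<not> affine_dependent B)"

definition convex_position :: "(real ^ 3) set \<Rightarrow> bool" where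
  "convex_position S \<longleftrightarrow> (\<forall>p\<in>S. p \<notin> convex hull (S - {p}))"

definition pairwise_dists :: "(real ^ 3) set \<Rightarrow> real set" where
  "pairwise_dists A = {dist x y | x y. x \<in> A \<and> y \<in> A \<and> x \<noteq> y}"

(* The ratio is meaningful only if A has at least two points; the value 0
   for smaller sets is a convention, so that no unspecified Max {} or Min {} occurs. *)
definition spread :: "(real ^ 3) set \<Rightarrow> real" where
  "spread A =
    (if card A < 2 then 0 else Max (pairwise_dists A) / Min (pairwise_dists A))"

end

theory Submission
  imports Defs
begin

text \<open>
  A counting version of a random construction: choose one point in each of \<open>n\<close> cells of a cubic grid
  with about \<open>n\<^sup>1\<^sup>/\<^sup>3\<close> cells per side, the offset within the cell ranging over a finite grid.
  Moving all candidates slightly puts them in general position.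

  At each point of a set in convex position there is a supporting plane, whose normal has its largest
  entry along one of six signed axes. The points of one axis lie on the graph of a minimum of affine
  functions with slopes in \<open>[-1, 1]\<close>. Rescale so that the graph lives over \<open>m \<times> m\<close> unit squares with
  \<open>m\<^sup>4 \<approx> n\<close> and Lipschitz constant \<open>m\<close>. Along each grid line the second differences have total mass
  \<open>O(m)\<close>, which has two consequences. The integer parts at the grid points can be coded row by row
  with \<open>O(m)\<close> bits, so there are \<open>2\<^sup>O\<^sup>(\<^sup>m\<^sup>\<cdot>\<^sup>m\<^sup>)\<close> codes; and the functions with a given code agree up to an
  error whose average over the squares is \<open>O(1)\<close>, so that their graphs share a neighbourhood with
  \<open>O(m\<^sup>2)\<close> expected points. An exponential moment bound and a union bound over
  codes and axes leave a choice in which every such neighbourhood contains \<open>O(m\<^sup>2) = O(n\<^sup>1\<^sup>/\<^sup>2)\<close> points.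
\<close>

subsection \<open>Separately concave functions\<close>

text \<open>Only the behaviour in each variable separately is recorded, because the estimates below
  go along grid lines. The domain is the whole plane, so second differences make sense at the border
  of any region.\<close>

definition sep_concave :: "real \<Rightarrow> (real \<Rightarrow> real \<Rightarrow> real) \<Rightarrow> bool" where
  "sep_concave L f \<longleftrightarrow>
    (\<forall>y. concave_on UNIV (\<lambda>x. f x y)) \<and> (\<forall>x. concave_on UNIV (f x)) \<and>
    (\<forall>x x' y. \<bar>f x y - f x' y\<bar> \<le> L * \<bar>x - x'\<bar>) \<and>
    (\<forall>x y y'. \<bar>f x y - f x y'\<bar> \<le> L * \<bar>y - y'\<bar>)"

lemma concave_on_UNIV_interpolation_le:
  fixes h :: "real \<Rightarrow> real"
  assumes "concave_on UNIV h" "0 \<le> t" "t \<le> 1"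
  shows "(1 - t) * h a + t * h (a + 1) \<le> h (a + t)"
proof -
  have "(1 - t) * h a + t * h (a + 1) \<le> h ((1 - t) *\<^sub>R a + t *\<^sub>R (a + 1))"
    using assms by (intro concave_onD) auto
  then show ?thesis by (simp add: algebra_simps)
qed

lemma concave_on_UNIV_second_diff_nonneg:
  fixes h :: "real \<Rightarrow> real"
  assumes "concave_on UNIV h"
  shows "0 \<le> 2 * h a - h (a - 1) - h (a + 1)"
proof -
  have "(1 - 1/2) * h (a - 1) + (1/2) * h (a + 1) \<le> h ((1 - 1/2) *\<^sub>R (a - 1) + (1/2) *\<^sub>R (a + 1))"
    using assms by (intro concave_onD) auto
  then show ?thesis by (simp add: field_simps)
qed

text \<open>The chord from \<open>a - 1\<close> to \<open>a\<close>, prolonged beyond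
  \<open>a\<close>, lies above the graph. It exceeds the chord from \<open>a\<close> to
  \<open>a + 1\<close> by \<open>t\<close> times the negated second difference at
  \<open>a\<close>.\<close>

lemma concave_on_UNIV_le_interpolation:
  fixes h :: "real \<Rightarrow> real"
  assumes h: "concave_on UNIV h" and t: "0 \<le> t" "t \<le> 1"
  shows "h (a + t) \<le> (1 - t) * h a + t * h (a + 1) + (2 * h a - h (a - 1) - h (a + 1))"
proof -
  define D where "D = 2 * h a - h (a - 1) - h (a + 1)"
  \<comment> \<open>The weight that makes \<open>a\<close> a convex combination of
    \<open>a - 1\<close> and \<open>a + t\<close>.\<close>
  define s where "s = 1 / (1 + t)"
  have s: "0 \<le> s" "s \<le> 1" "s * (1 + t) = 1" using t by (auto simp: s_def)
  have "(1 - s) * h (a - 1) + s * h (a + t) \<le> h ((1 - s) *\<^sub>R (a - 1) + s *\<^sub>R (a + t))"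
    using h s by (intro concave_onD) auto
  also have "(1 - s) *\<^sub>R (a - 1) + s *\<^sub>R (a + t) = a"
    using s by (simp add: algebra_simps)
  finally have "(1 + t) * ((1 - s) * h (a - 1) + s * h (a + t)) \<le> (1 + t) * h a"
    using t by (intro mult_left_mono) auto
  also have "(1 + t) * ((1 - s) * h (a - 1) + s * h (a + t)) =
      ((1 + t) - s * (1 + t)) * h (a - 1) + (s * (1 + t)) * h (a + t)"
    by (simp add: algebra_simps)
  finally have "t * h (a - 1) + h (a + t) \<le> (1 + t) * h a" using s by simp
  then have "h (a + t) \<le> (1 - t) * h a + t * h (a + 1) + t * D"
    by (simp add: D_def algebra_simps)
  moreover have "t * D \<le> D"
    using concave_on_UNIV_second_diff_nonneg[OF h, of a] t
    by (intro mult_left_le_one_le) (auto simp: D_def)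
  ultimately show ?thesis by (simp add: D_def)
qed

text \<open>The sign is the one that makes second differences of concave functions nonnegative;
  likewise for \<open>diff2\<close>.\<close>

definition diff1 :: "(real \<Rightarrow> real \<Rightarrow> real) \<Rightarrow> real \<Rightarrow> real \<Rightarrow> real" where
  "diff1 g x y = 2 * g x y - g (x - 1) y - g (x + 1) y"

definition diff2 :: "(real \<Rightarrow> real \<Rightarrow> real) \<Rightarrow> real \<Rightarrow> real \<Rightarrow> real" where
  "diff2 g x y = 2 * g x y - g x (y - 1) - g x (y + 1)"

definition bilin :: "(real \<Rightarrow> real \<Rightarrow> real) \<Rightarrow> real \<Rightarrow> real \<Rightarrow> real \<Rightarrow> real \<Rightarrow> real" where
  "bilin g x y s t = (1 - s) * ((1 - t) * g x y + t * g x (y + 1))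
     + s * ((1 - t) * g (x + 1) y + t * g (x + 1) (y + 1))"

text \<open>Bounds how far a separately concave function exceeds the bilinear interpolation of its values at
  the corners of a unit square.\<close>
definition gap :: "(real \<Rightarrow> real \<Rightarrow> real) \<Rightarrow> real \<Rightarrow> real \<Rightarrow> real" where
  "gap g x y = diff1 g x y + diff1 g x (y + 1) + 3 * diff2 g x y + diff2 g (x + 1) y"

lemma sep_concave_concave1: "sep_concave L g \<Longrightarrow> concave_on UNIV (\<lambda>x. g x y)"
  and sep_concave_concave2: "sep_concave L g \<Longrightarrow> concave_on UNIV (g x)"
  by (auto simp: sep_concave_def)

lemma sep_concave_lipschitz:
  assumes "sep_concave L g"
  shows "\<bar>g x y - g x' y'\<bar> \<le> L * (\<bar>x - x'\<bar> + \<bar>y - y'\<bar>)"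
proof -
  have "\<bar>g x y - g x' y\<bar> \<le> L * \<bar>x - x'\<bar>" "\<bar>g x' y - g x' y'\<bar> \<le> L * \<bar>y - y'\<bar>"
    using assms by (auto simp: sep_concave_def)
  then show ?thesis by (simp add: algebra_simps)
qed

lemma diff1_nonneg: "sep_concave L g \<Longrightarrow> 0 \<le> diff1 g x y"
  unfolding diff1_def by (rule concave_on_UNIV_second_diff_nonneg[OF sep_concave_concave1])

lemma diff2_nonneg: "sep_concave L g \<Longrightarrow> 0 \<le> diff2 g x y"
  unfolding diff2_def by (rule concave_on_UNIV_second_diff_nonneg[OF sep_concave_concave2])

lemma gap_nonneg: "sep_concave L g \<Longrightarrow> 0 \<le> gap g x y"
  by (simp add: gap_def diff1_nonneg diff2_nonneg)

lemma bilin_le: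
  assumes g: "sep_concave L g" and st: "0 \<le> s" "s \<le> 1" "0 \<le> t" "t \<le> 1"
  shows "bilin g x y s t \<le> g (x + s) (y + t)"
proof -
  have "bilin g x y s t \<le> (1 - s) * g x (y + t) + s * g (x + 1) (y + t)"
    unfolding bilin_def using st
    by (intro add_mono mult_left_mono concave_on_UNIV_interpolation_le sep_concave_concave2[OF g]) auto
  also have "\<dots> \<le> g (x + s) (y + t)"
    by (rule concave_on_UNIV_interpolation_le[OF sep_concave_concave1[OF g] st(1,2)])
  finally show ?thesis .
qed

text \<open>Upper interpolation is applied in \<open>x\<close> first and then in \<open>y\<close> on
  two opposite sides of the square; the second differences collected on the way make up
  \<open>gap\<close>.\<close>

lemma le_bilin_gap:
  assumes g: "sep_concave L g" and st: "0 \<le> s" "s \<le> 1" "0 \<le> t" "t \<le> 1"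
  shows "g (x + s) (y + t) \<le> bilin g x y s t + gap g x y"
proof -
  have up: "g u (y + t) \<le> (1 - t) * g u y + t * g u (y + 1) + diff2 g u y" for u
    unfolding diff2_def
    by (rule concave_on_UNIV_le_interpolation[OF sep_concave_concave2[OF g] st(3,4)])
  have lo: "(1 - t) * g u y + t * g u (y + 1) \<le> g u (y + t)" for u
    by (rule concave_on_UNIV_interpolation_le[OF sep_concave_concave2[OF g] st(3,4)])
  have "g (x + s) (y + t) \<le> (1 - s) * g x (y + t) + s * g (x + 1) (y + t) + diff1 g x (y + t)"
    unfolding diff1_def
    by (rule concave_on_UNIV_le_interpolation[OF sep_concave_concave1[OF g] st(1,2)])
  moreover have "(1 - s) * g x (y + t) + s * g (x + 1) (y + t)
      \<le> (1 - s) * ((1 - t) * g x y + t * g x (y + 1) + diff2 g x y)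
        + s * ((1 - t) * g (x + 1) y + t * g (x + 1) (y + 1) + diff2 g (x + 1) y)"
    using st by (intro add_mono mult_left_mono up) auto
  moreover have "\<dots> = bilin g x y s t + (1 - s) * diff2 g x y + s * diff2 g (x + 1) y"
    by (simp add: bilin_def algebra_simps)
  moreover have "(1 - s) * diff2 g x y \<le> diff2 g x y" "s * diff2 g (x + 1) y \<le> diff2 g (x + 1) y"
    using st diff2_nonneg[OF g] by (auto intro!: mult_left_le_one_le)
  \<comment> \<open>At height \<open>y + t\<close>, in general off the grid, the positive term of
    \<open>diff1\<close> is interpolated from above and the two negative ones from below. The error
    \<open>2 * diff2 g x y\<close> joins the one already present, hence the coefficient 3 in
    \<open>gap\<close>.\<close>
  moreover have "diff1 g x (y + t) \<le> (1 - t) * diff1 g x y + t * diff1 g x (y + 1) + 2 * diff2 g x y"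
    using up[of x] lo[of "x - 1"] lo[of "x + 1"] unfolding diff1_def
    by (simp add: algebra_simps)
  moreover have "(1 - t) * diff1 g x y \<le> diff1 g x y" "t * diff1 g x (y + 1) \<le> diff1 g x (y + 1)"
    using st diff1_nonneg[OF g] by (auto intro!: mult_left_le_one_le)
  ultimately show ?thesis unfolding gap_def by linarith
qed

text \<open>Each function lies between the bilinear interpolation of its corner values and that
  interpolation plus its own gap, and the two interpolations differ by at most 1. The bound contains
  only the gap of \<open>h\<close>, so with a fixed net element as \<open>h\<close> it is uniform
  over all \<open>g\<close> close to it.\<close>

lemma sep_concave_close:
  fixes i j m :: nat and s t :: real
  assumes g: "sep_concave L g" and h: "sep_concave L h"
    and close: "\<And>a b. a \<le> m + 1 \<Longrightarrow> b \<le> m + 1 \<Longrightarrow> \<bar>g (real a) (real b) - h (real a) (real b)\<bar> \<le> 1"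
    and ij: "1 \<le> i" "i \<le> m" "1 \<le> j" "j \<le> m"
    and st: "0 \<le> s" "s \<le> 1" "0 \<le> t" "t \<le> 1"
  shows "\<bar>g (real i + s) (real j + t) - h (real i + s) (real j + t)\<bar> \<le> 25 + gap h i j"
proof -
  have c: "\<bar>g x y - h x y\<bar> \<le> 1"
    if "x \<in> {real i - 1, real i, real i + 1}" "y \<in> {real j - 1, real j, real j + 1}" for x y
  proof -
    have "x \<in> real ` {i - 1, i, i + 1}" "y \<in> real ` {j - 1, j, j + 1}"
      using that ij by (auto simp: of_nat_diff)
    then obtain a b where "x = real a" "y = real b" "a \<in> {i - 1, i, i + 1}" "b \<in> {j - 1, j, j + 1}"
      by blast
    with close[of a b] ij show ?thesis by auto
  qed
  have comb: "\<bar>(1 - r) * u + r * v\<bar> \<le> 1" if "0 \<le> r" "r \<le> 1" "\<bar>u\<bar> \<le> 1" "\<bar>v\<bar> \<le> 1" for r u v :: real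
  proof -
    have "\<bar>(1 - r) * u + r * v\<bar> \<le> (1 - r) * \<bar>u\<bar> + r * \<bar>v\<bar>"
      using that abs_triangle_ineq[of "(1 - r) * u" "r * v"] by (simp add: abs_mult)
    also have "\<dots> \<le> 1" using that by (intro convex_bound_le) auto
    finally show ?thesis .
  qed
  have "bilin g i j s t - bilin h i j s t
     = (1 - s) * ((1 - t) * (g (real i) (real j) - h (real i) (real j))
         + t * (g (real i) (real j + 1) - h (real i) (real j + 1)))
     + s * ((1 - t) * (g (real i + 1) (real j) - h (real i + 1) (real j))
         + t * (g (real i + 1) (real j + 1) - h (real i + 1) (real j + 1)))"
    by (simp add: bilin_def algebra_simps)
  moreover have "\<bar>\<dots>\<bar> \<le> 1"
    using st by (intro comb c) auto
  ultimately have b: "\<bar>bilin g i j s t - bilin h i j s t\<bar> \<le> 1" by simp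
  \<comment> \<open>A second difference changes by at most 4 if its values change by at most 1, and
    the weights in \<open>gap\<close> add up to 6.\<close>
  have e1: "gap g i j \<le> gap h i j + 24"
    using c[of "real i" "real j"] c[of "real i - 1" "real j"] c[of "real i + 1" "real j"]
      c[of "real i" "real j + 1"] c[of "real i - 1" "real j + 1"]
      c[of "real i + 1" "real j + 1"]
      c[of "real i" "real j - 1"] c[of "real i + 1" "real j - 1"]
    unfolding gap_def diff1_def diff2_def by (simp add: abs_le_iff)
  have "g (real i + s) (real j + t) \<le> bilin g i j s t + gap g i j" "h (real i + s) (real j + t) \<le> bilin h i j s t + gap h i j"
      "bilin g i j s t \<le> g (real i + s) (real j + t)" "bilin h i j s t \<le> h (real i + s) (real j + t)"
    by (intro le_bilin_gap[OF g st] le_bilin_gap[OF h st] bilin_le[OF g st] bilin_le[OF h st])+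
  with b e1 show ?thesis by linarith
qed

lemma sum_second_diff_telescope:
  fixes f :: "nat \<Rightarrow> 'a::comm_ring_1"
  shows "(\<Sum>i=1..m. 2 * f i - f (i - 1) - f (i + 1)) = (f 1 - f 0) - (f (m + 1) - f m)"
  by (induction m) (auto simp: algebra_simps)

text \<open>The second differences telescope to the first slope minus the last, each of size at most
  \<open>L\<close>.\<close>

lemma sum_diff1_le:
  assumes "sep_concave L g"
  shows "(\<Sum>i=1..m. diff1 g (real i) y) \<le> 2 * L"
proof -
  have "(\<Sum>i=1..m. diff1 g (real i) y) =
      (\<Sum>i=1..m. 2 * g (real i) y - g (real (i - 1)) y - g (real (i + 1)) y)"
    by (intro sum.cong) (auto simp: diff1_def of_nat_diff add.commute)
  also have "\<dots> = (g (real 1) y - g (real 0) y) - (g (real (m + 1)) y - g (real m) y)"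
    by (rule sum_second_diff_telescope)
  finally show ?thesis
    using sep_concave_lipschitz[OF assms, of 1 y 0 y]
      sep_concave_lipschitz[OF assms, of "real (m + 1)" y "real m" y] by simp
qed

lemma sum_diff2_le:
  assumes "sep_concave L g"
  shows "(\<Sum>j=1..m. diff2 g x (real j)) \<le> 2 * L"
proof -
  have "sep_concave L (\<lambda>x y. g y x)" using assms by (auto simp: sep_concave_def)
  from sum_diff1_le[OF this, where m = m and y = x] show ?thesis by (simp add: diff1_def diff2_def)
qed

text \<open>Total weight 6, times \<open>2 * L\<close> for each of \<open>m\<close> grid lines. With
  \<open>L = m\<close> the gap is at most 12 on average over the \<open>m * m\<close>
  squares.\<close>

lemma sum_gap_le:
  assumes g: "sep_concave L g"
  shows "(\<Sum>i=1..m. \<Sum>j=1..m. gap g (real i) (real j)) \<le> 12 * L * m"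
proof -
  have "(\<Sum>i=1..m. \<Sum>j=1..m. diff1 g (real i) (real j + c)) \<le> 2 * L * m" for c
    using sum_mono[of "{1..m}" "\<lambda>j. \<Sum>i=1..m. diff1 g (real i) (real j + c)" "\<lambda>_. 2 * L"]
      sum_diff1_le[OF g] by (subst sum.swap) (simp add: mult.commute)
  note d1 = this[of 0] this[of 1]
  have "(\<Sum>i=1..m. \<Sum>j=1..m. diff2 g (real i + c) (real j)) \<le> 2 * L * m" for c
    using sum_mono[of "{1..m}" "\<lambda>i. \<Sum>j=1..m. diff2 g (real i + c) (real j)" "\<lambda>_. 2 * L"]
      sum_diff2_le[OF g] by (simp add: mult.commute)
  note d2 = this[of 0] this[of 1]
  show ?thesis
    using d1 d2 unfolding gap_def sum.distrib sum_distrib_left[symmetric] by simp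
qed

subsection \<open>Coding by rounded grid values\<close>

text \<open>Prepending the slack \<open>s - sum_list l\<close> gives lists of length
  \<open>m + 1\<close> with sum exactly \<open>s\<close>, which a binomial coefficient
  counts.\<close>

lemma card_lists_sum_le:
  "finite {l::nat list. length l = m \<and> sum_list l \<le> s}"
  "card {l::nat list. length l = m \<and> sum_list l \<le> s} \<le> 2 ^ (s + m)"
proof -
  let ?A = "{l::nat list. length l = m \<and> sum_list l \<le> s}"
  let ?B = "{l::nat list. length l = Suc m \<and> sum_list l = s}"
  let ?f = "\<lambda>l. (s - sum_list l) # l"
  have "?B \<subseteq> {l. set l \<subseteq> {..s} \<and> length l = Suc m}"
    using member_le_sum_list by (auto simp del: sum_list_eq_0_iff)
  then have fB: "finite ?B" by (rule finite_subset) (intro finite_lists_length_eq finite_atMost)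
  have inj: "inj_on ?f ?A" by (auto simp: inj_on_def)
  have sub: "?f ` ?A \<subseteq> ?B" by auto
  show "finite ?A" using inj_on_finite[OF inj sub fB] .
  have "card ?A \<le> card ?B" by (rule card_inj_on_le[OF inj sub fB])
  also have "\<dots> = (s + m) choose s" using card_length_sum_list[of "Suc m" s] by simp
  also have "\<dots> \<le> 2 ^ (s + m)" by (rule binomial_le_pow2)
  finally show "card ?A \<le> 2 ^ (s + m)" .
qed

text \<open>The summand 2 makes up for the rounding: second differences of the integer parts of a concave
  sequence can be as small as \<open>-1\<close>, so that without it \<open>nat\<close> would lose information.\<close>
definition row_code :: "nat \<Rightarrow> (real \<Rightarrow> real \<Rightarrow> real) \<Rightarrow> nat \<Rightarrow> int \<times> int \<times> nat list" where
  "row_code m g j = (\<lfloor>g (real 0) (real j)\<rfloor>, \<lfloor>g (real 1) (real j)\<rfloor>,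
     map (\<lambda>i. nat (2 * \<lfloor>g (real i) (real j)\<rfloor> - \<lfloor>g (real (i - 1)) (real j)\<rfloor> - \<lfloor>g (real (i + 1)) (real j)\<rfloor> + 2))
       [1..<m+1])"

lemma floor_second_diff_ge:
  assumes g: "sep_concave L g" and i: "1 \<le> i"
  shows "0 \<le> 2 * \<lfloor>g (real i) y\<rfloor> - \<lfloor>g (real (i - 1)) y\<rfloor> - \<lfloor>g (real (i + 1)) y\<rfloor> + 2"
proof -
  have "0 \<le> 2 * g (real i) y - g (real i - 1) y - g (real i + 1) y"
    using diff1_nonneg[OF g, of "real i" y] by (simp add: diff1_def)
  then have "0 \<le> 2 * g (real i) y - g (real (i - 1)) y - g (real (i + 1)) y"
    using i by (simp add: of_nat_diff add.commute)
  then show ?thesis by linarith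
qed

text \<open>The two initial values and the second differences determine the row recursively;
  \<open>nat\<close> loses nothing, since its arguments are nonnegative.\<close>

lemma row_code_eq_imp_floor_eq:
  assumes g: "sep_concave L g" and h: "sep_concave L' h"
    and eq: "row_code m g j = row_code m h j" and "i \<le> m + 1"
  shows "\<lfloor>g (real i) (real j)\<rfloor> = \<lfloor>h (real i) (real j)\<rfloor>"
  using \<open>i \<le> m + 1\<close>
proof (induction i rule: less_induct)
  case (less i)
  show ?case
  proof (cases "i \<le> 1")
    case True
    then have "i = 0 \<or> i = 1" by auto
    then show ?thesis using eq unfolding row_code_def by auto
  next
    case False
    \<comment> \<open>The entry for \<open>i - 1\<close> has \<open>i\<close> as its right
      neighbour, so it yields the value at \<open>i\<close> from the two values before it.\<close>
    define k where "k = i - 1"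
    have k: "i = k + 1" "1 \<le> k" "k \<in> set [1..<m+1]" using False less.prems by (auto simp: k_def)
    have "nat (2 * \<lfloor>g (real k) (real j)\<rfloor> - \<lfloor>g (real (k - 1)) (real j)\<rfloor> - \<lfloor>g (real (k + 1)) (real j)\<rfloor> + 2)
        = nat (2 * \<lfloor>h (real k) (real j)\<rfloor> - \<lfloor>h (real (k - 1)) (real j)\<rfloor> - \<lfloor>h (real (k + 1)) (real j)\<rfloor> + 2)"
      using eq k(3) unfolding row_code_def by (simp only: prod.inject map_eq_conv)
    then have "2 * \<lfloor>g (real k) (real j)\<rfloor> - \<lfloor>g (real (k - 1)) (real j)\<rfloor> - \<lfloor>g (real (k + 1)) (real j)\<rfloor>
        = 2 * \<lfloor>h (real k) (real j)\<rfloor> - \<lfloor>h (real (k - 1)) (real j)\<rfloor> - \<lfloor>h (real (k + 1)) (real j)\<rfloor>"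
      using floor_second_diff_ge[OF g k(2), of "real j"] floor_second_diff_ge[OF h k(2), of "real j"]
      by linarith
    then show ?thesis using less.IH[of k] less.IH[of "k - 1"] k less.prems by simp
  qed
qed

text \<open>Single entries may be large, but their sum telescopes and is \<open>O(m)\<close>. This
  is what brings the cost of a row down to \<open>O(m)\<close> bits.\<close>

lemma row_code_in_range:
  assumes g: "sep_concave (real m) g" and g0: "\<bar>g 0 0\<bar> \<le> 8 * (real m)\<^sup>2" and m: "1 \<le> m" and j: "j \<le> m + 1"
  shows "row_code m g j \<in> {-12 * int (m\<^sup>2)..12 * int (m\<^sup>2)} \<times> {-12 * int (m\<^sup>2)..12 * int (m\<^sup>2)}
    \<times> {l. length l = m \<and> sum_list l \<le> 6 * m}"
proof -
  let ?F = "\<lambda>i. \<lfloor>g (real i) (real j)\<rfloor>"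
  have mm: "real m \<le> (real m)\<^sup>2" "1 \<le> (real m)\<^sup>2" using m by (auto intro: self_le_power)
  have bnd: "\<lfloor>g (real a) (real j)\<rfloor> \<in> {-12 * int (m\<^sup>2)..12 * int (m\<^sup>2)}" if "a \<le> 1" for a
  proof -
    have "\<bar>g (real a) (real j) - g 0 0\<bar> \<le> real m * (real a + real j)"
      using sep_concave_lipschitz[OF g, of "real a" "real j" 0 0] by simp
    also have "\<dots> \<le> real m * (real m + 2)" using that j by (intro mult_left_mono) auto
    also have "\<dots> \<le> 3 * (real m)\<^sup>2" using mm by (simp add: power2_eq_square algebra_simps)
    finally have "\<bar>g (real a) (real j)\<bar> \<le> 11 * (real m)\<^sup>2" using g0 by linarith
    then have "\<bar>g (real a) (real j)\<bar> \<le> real_of_int (11 * int (m\<^sup>2))" by simp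
    \<comment> \<open>Rounding down costs at most 1, which the passage from 11 to 12
      absorbs.\<close>
    moreover have "1 \<le> int (m\<^sup>2)" using m by simp
    ultimately show ?thesis unfolding atLeastAtMost_iff by linarith
  qed
  have "int (sum_list (map (\<lambda>i. nat (2 * ?F i - ?F (i - 1) - ?F (i + 1) + 2)) [1..<m+1]))
      = (\<Sum>i=1..m. int (nat (2 * ?F i - ?F (i - 1) - ?F (i + 1) + 2)))"
    by (simp add: sum_list_distinct_conv_sum_set atLeastLessThanSuc_atLeastAtMost del: upt_Suc)
  also have "\<dots> = (\<Sum>i=1..m. (2 * ?F i - ?F (i - 1) - ?F (i + 1)) + 2)"
    using floor_second_diff_ge[OF g] by (intro sum.cong) auto
  also have "\<dots> = ((?F 1 - ?F 0) - (?F (m + 1) - ?F m)) + 2 * int m"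
    unfolding sum.distrib sum_second_diff_telescope[of ?F m] by simp
  \<comment> \<open>Two rounded slopes of at most \<open>m + 1\<close> and \<open>m\<close> shifts
    by 2 give \<open>4 * m + 2\<close>.\<close>
  also have "\<dots> \<le> 6 * int m"
  proof -
    have "\<bar>g (real 1) (real j) - g (real 0) (real j)\<bar> \<le> real m"
      "\<bar>g (real (m + 1)) (real j) - g (real m) (real j)\<bar> \<le> real m"
      using sep_concave_lipschitz[OF g, of "real 1" "real j" "real 0" "real j"]
        sep_concave_lipschitz[OF g, of "real (m + 1)" "real j" "real m" "real j"] by auto
    then have "?F 1 - ?F 0 \<le> int m + 1" "?F m - ?F (m + 1) \<le> int m + 1" by linarith+
    then show ?thesis using m by linarith
  qed
  finally have "sum_list (map (\<lambda>i. nat (2 * ?F i - ?F (i - 1) - ?F (i + 1) + 2)) [1..<m+1]) \<le> 6 * m"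
    by linarith
  then show ?thesis using bnd[of 0] bnd[of 1] unfolding row_code_def by simp
qed

text \<open>Functions with equal codes in all rows have equal integer parts on the grid, so they
  differ there by less than 1. One function for each occurring code forms the net.\<close>

lemma sep_concave_net:
  fixes m :: nat
  assumes m: "1 \<le> m"
  obtains G where "finite G" "card G \<le> 2 ^ (63 * m\<^sup>2)" "\<And>g. g \<in> G \<Longrightarrow> sep_concave (real m) g"
    "\<And>f. sep_concave (real m) f \<Longrightarrow> \<bar>f 0 0\<bar> \<le> 8 * (real m)\<^sup>2 \<Longrightarrow>
      \<exists>g\<in>G. \<forall>a\<le>m+1. \<forall>b\<le>m+1. \<bar>f (real a) (real b) - g (real a) (real b)\<bar> \<le> 1"
proof -
  define F where "F = {f. sep_concave (real m) f \<and> \<bar>f 0 0\<bar> \<le> 8 * (real m)\<^sup>2}"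
  define code where "code f = restrict (row_code m f) {..m+1}" for f
  define Rows where "Rows = {-12 * int (m\<^sup>2)..12 * int (m\<^sup>2)} \<times> {-12 * int (m\<^sup>2)..12 * int (m\<^sup>2)}
    \<times> {l::nat list. length l = m \<and> sum_list l \<le> 6 * m}"
  have finR: "finite Rows" unfolding Rows_def by (intro finite_cartesian_product card_lists_sum_le finite_atLeastAtMost_int)
  have m2: "m\<^sup>2 \<le> 2 ^ (2 * m)"
    using power_mono[OF less_imp_le[OF less_exp[of m]], of 2] by (simp add: power_mult[symmetric] mult.commute)
  have "1 \<le> int (m\<^sup>2)" using m by simp
  then have "nat (12 * int (m\<^sup>2) + 1 - (-12 * int (m\<^sup>2))) \<le> 2 ^ 5 * m\<^sup>2"
    unfolding nat_le_iff by simp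
  also have "\<dots> \<le> 2 ^ (5 * m) * 2 ^ (2 * m)" using m by (intro mult_mono m2 power_increasing) auto
  finally have c1: "card {-12 * int (m\<^sup>2)..12 * int (m\<^sup>2)} \<le> 2 ^ (7 * m)" by (simp add: power_add[symmetric])
  \<comment> \<open>Each initial value takes \<open>7 * m\<close> bits and the list takes
    \<open>6 * m + m\<close>.\<close>
  have "card Rows \<le> 2 ^ (7 * m) * (2 ^ (7 * m) * 2 ^ (6 * m + m))"
    unfolding Rows_def card_cartesian_product by (intro mult_mono c1 card_lists_sum_le) auto
  then have cR: "card Rows \<le> 2 ^ (21 * m)" by (simp add: power_add[symmetric])
  have sub: "code ` F \<subseteq> PiE {..m+1} (\<lambda>_. Rows)"
  proof (rule image_subsetI)
    fix f assume "f \<in> F"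
    then have "row_code m f j \<in> Rows" if "j \<le> m + 1" for j
      unfolding Rows_def using row_code_in_range m that by (simp only: F_def mem_Collect_eq)
    then show "code f \<in> PiE {..m+1} (\<lambda>_. Rows)" unfolding code_def restrict_PiE_iff by simp
  qed
  have finP: "finite (PiE {..m+1} (\<lambda>_. Rows))" using finR by (intro finite_PiE) auto
  have "card (code ` F) \<le> card (PiE {..m+1} (\<lambda>_. Rows))" by (rule card_mono[OF finP sub])
  also have "\<dots> = card Rows ^ (m + 2)" by (simp add: card_PiE)
  also have "\<dots> \<le> (2 ^ (21 * m)) ^ (m + 2)" by (intro power_mono cR) auto
  also have "\<dots> = 2 ^ (21 * m * (m + 2))" by (simp only: power_mult)
  \<comment> \<open>There are \<open>m + 2\<close> rows, which is at most
    \<open>3 * m\<close>.\<close>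
  also have "\<dots> \<le> 2 ^ (63 * m\<^sup>2)" using m by (intro power_increasing) (auto simp: power2_eq_square)
  finally have card: "card (code ` F) \<le> 2 ^ (63 * m\<^sup>2)" .
  have finC: "finite (code ` F)" using finite_subset[OF sub finP] .
  let ?G = "inv_into F code ` code ` F"
  show ?thesis
  proof (rule that)
    show "finite ?G" using finC by simp
    show "card ?G \<le> 2 ^ (63 * m\<^sup>2)" using card_image_le[OF finC] card by (rule order_trans)
    show "sep_concave (real m) g" if "g \<in> ?G" for g
      using that inv_into_into[of _ code F] by (auto simp: F_def)
    fix f assume f: "sep_concave (real m) f" "\<bar>f 0 0\<bar> \<le> 8 * (real m)\<^sup>2"
    then have fF: "f \<in> F" by (simp add: F_def)
    let ?g = "inv_into F code (code f)"
    have gF: "?g \<in> F" and ge: "code ?g = code f" using fF by (simp_all add: inv_into_into f_inv_into_f)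
    have "\<bar>f (real a) (real b) - ?g (real a) (real b)\<bar> \<le> 1" if "a \<le> m + 1" "b \<le> m + 1" for a b
    proof -
      have "row_code m f b = row_code m ?g b" using fun_cong[OF ge, of b] that by (simp add: code_def)
      with f gF that have "\<lfloor>f (real a) (real b)\<rfloor> = \<lfloor>?g (real a) (real b)\<rfloor>"
        by (intro row_code_eq_imp_floor_eq[of "real m" _ "real m"]) (auto simp: F_def)
      then show ?thesis by linarith
    qed
    then show "\<exists>g\<in>?G. \<forall>a\<le>m+1. \<forall>b\<le>m+1. \<bar>f (real a) (real b) - g (real a) (real b)\<bar> \<le> 1"
      using fF by blast
  qed
qed

subsection \<open>Choices, perturbations and supporting planes\<close>

text \<open>An exponential moment bound in counting form. Averaged over all choices, 2 to the number
  of hits of \<open>R\<close> factorises over \<open>C\<close> and is at most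
  \<open>exp \<mu>\<close>. So a fraction of at most \<open>exp \<mu> / 2 ^ k\<close> of the choices
  has \<open>k\<close> or more hits, and a union bound over \<open>\<R>\<close> leaves a good
  choice.\<close>

lemma exists_choice_avoiding:
  fixes C :: "'c set" and D :: "'d set" and \<R> :: "('c \<times> 'd) set set"
  assumes fin: "finite C" "finite D" "D \<noteq> {}" "finite \<R>"
    and small: "\<And>R. R \<in> \<R> \<Longrightarrow> real (card (R \<inter> C \<times> D)) \<le> \<mu> * real (card D)"
    and few: "real (card \<R>) * exp \<mu> < 2 ^ k"
  obtains g where "\<And>c. c \<in> C \<Longrightarrow> g c \<in> D" "\<And>R. R \<in> \<R> \<Longrightarrow> card {c \<in> C. (c, g c) \<in> R} < k"
proof -
  let ?W = "real (card D)"
  let ?P = "PiE C (\<lambda>_. D)"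
  define bad where "bad R = {g \<in> ?P. k \<le> card {c \<in> C. (c, g c) \<in> R}}" for R
  have finP: "finite ?P" using fin by (intro finite_PiE) auto
  have W: "0 < ?W" using fin by (simp add: card_gt_0_iff)
  have cP: "real (card ?P) = ?W ^ card C" using fin by (simp add: card_PiE)
  have bad_le: "real (card (bad R)) * 2 ^ k \<le> ?W ^ card C * exp \<mu>" if R: "R \<in> \<R>" for R
  proof -
    let ?r = "\<lambda>c. card {d \<in> D. (c, d) \<in> R}"
    have "real (card (bad R)) * 2 ^ k = (\<Sum>g\<in>bad R. 2 ^ k)" by simp
    also have "\<dots> \<le> (\<Sum>g\<in>bad R. 2 ^ card {c \<in> C. (c, g c) \<in> R})"
      by (intro sum_mono power_increasing) (auto simp: bad_def)
    also have "\<dots> \<le> (\<Sum>g\<in>?P. 2 ^ card {c \<in> C. (c, g c) \<in> R})"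
      by (intro sum_mono2 finP) (auto simp: bad_def)
    also have "\<dots> = (\<Sum>g\<in>?P. \<Prod>c\<in>C. if (c, g c) \<in> R then 2 else 1)"
    proof (intro sum.cong refl)
      fix g
      have "(\<Prod>c\<in>C. if (c, g c) \<in> R then 2 else 1) = (\<Prod>c\<in>{c\<in>C. (c, g c) \<in> R}. 2::real)"
        using fin(1) by (rule prod.inter_filter[symmetric])
      then show "2 ^ card {c \<in> C. (c, g c) \<in> R} = (\<Prod>c\<in>C. if (c, g c) \<in> R then 2 else (1::real))"
        by simp
    qed
    \<comment> \<open>Interchanging sum and product is the independence of the choices for different
      \<open>c\<close>.\<close>
    also have "\<dots> = (\<Prod>c\<in>C. \<Sum>d\<in>D. if (c, d) \<in> R then 2 else 1)"
      using fin by (intro prod_sum_PiE[symmetric]) auto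
    also have "\<dots> = (\<Prod>c\<in>C. ?W + real (?r c))"
    proof (intro prod.cong refl)
      fix c
      have "(\<Sum>d\<in>D. if (c, d) \<in> R then 2 else 1) = (\<Sum>d\<in>D. 1 + (if (c, d) \<in> R then 1 else (0::real)))"
        by (intro sum.cong) auto
      also have "\<dots> = ?W + (\<Sum>d\<in>{d\<in>D. (c, d) \<in> R}. 1)"
        using fin(2) by (simp add: sum.distrib sum.inter_filter[symmetric])
      finally show "(\<Sum>d\<in>D. if (c, d) \<in> R then 2 else 1) = ?W + real (?r c)" by simp
    qed
    also have "\<dots> \<le> (\<Prod>c\<in>C. ?W * exp (real (?r c) / ?W))"
    proof (intro prod_mono conjI)
      fix c
      have "?W + real (?r c) = ?W * (1 + real (?r c) / ?W)" using W by (simp add: field_simps)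
      also have "\<dots> \<le> ?W * exp (real (?r c) / ?W)"
        using W exp_ge_add_one_self[of "real (?r c) / ?W"] by (intro mult_left_mono) auto
      finally show "?W + real (?r c) \<le> ?W * exp (real (?r c) / ?W)" .
    qed auto
    also have "\<dots> = ?W ^ card C * exp ((\<Sum>c\<in>C. real (?r c)) / ?W)"
      using fin by (simp add: prod.distrib exp_sum sum_divide_distrib)
    also have "(\<Sum>c\<in>C. real (?r c)) = real (card (R \<inter> C \<times> D))"
    proof -
      have "R \<inter> C \<times> D = (SIGMA c:C. {d \<in> D. (c, d) \<in> R})" by auto
      then show ?thesis using fin by (simp add: card_SigmaI)
    qed
    also have "?W ^ card C * exp (real (card (R \<inter> C \<times> D)) / ?W) \<le> ?W ^ card C * exp \<mu>"
      using small[OF R] W by (intro mult_left_mono) (auto simp: field_simps)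
    finally show ?thesis .
  qed
  have "real (card (\<Union>R\<in>\<R>. bad R)) * 2 ^ k \<le> (\<Sum>R\<in>\<R>. real (card (bad R))) * 2 ^ k"
    using card_UN_le[OF fin(4), of bad] by (intro mult_right_mono) (simp_all flip: of_nat_sum)
  also have "\<dots> = (\<Sum>R\<in>\<R>. real (card (bad R)) * 2 ^ k)" by (rule sum_distrib_right)
  also have "\<dots> \<le> (\<Sum>R\<in>\<R>. ?W ^ card C * exp \<mu>)" by (intro sum_mono bad_le)
  also have "\<dots> = ?W ^ card C * (real (card \<R>) * exp \<mu>)" by simp
  also have "\<dots> < real (card ?P) * 2 ^ k"
    unfolding cP using W few by (intro mult_strict_left_mono) auto
  finally have "card (\<Union>R\<in>\<R>. bad R) < card ?P" by simp
  then have "\<not> ?P \<subseteq> (\<Union>R\<in>\<R>. bad R)"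
    using finP fin(4) by (auto simp: bad_def dest!: card_mono[rotated])
  then obtain g where g: "g \<in> ?P" "g \<notin> (\<Union>R\<in>\<R>. bad R)" by blast
  show ?thesis
  proof (rule that[of g])
    show "card {c \<in> C. (c, g c) \<in> R} < k" if "R \<in> \<R>" for R
      using g that by (auto simp: bad_def)
  qed (use g in auto)
qed

text \<open>Points are placed one after another. The affine hulls of at most three earlier points
  are finitely many null sets and cannot cover a ball; a point outside all of them extends
  independent sets to independent sets.\<close>

lemma exists_near_general_position:
  fixes q :: "'i \<Rightarrow> real ^ 3"
  assumes "finite I" "0 < \<delta>"
  shows "\<exists>p. (\<forall>i\<in>I. dist (q i) (p i) < \<delta>) \<and> inj_on p I \<and> general_position (p ` I)"
  using assms(1)
proof (induction I)
  case empty
  have "\<not> affine_dependent B" if "B \<subseteq> {}" for B :: "(real ^ 3) set"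
    using that by (auto simp: affine_dependent_def)
  then show ?case by (simp add: general_position_def affine_dependent_def)
next
  case (insert i I)
  then obtain p where p: "\<And>j. j \<in> I \<Longrightarrow> dist (q j) (p j) < \<delta>" "inj_on p I" "general_position (p ` I)"
    by blast
  define \<B> where "\<B> = {B. B \<subseteq> p ` I \<and> card B \<le> 3}"
  have fin: "finite \<B>"
    using insert.hyps(1) finite_subset[of \<B> "Pow (p ` I)"] by (auto simp: \<B>_def)
  have "negligible (affine hull B)" if "B \<in> \<B>" for B
  proof -
    have "finite B" using that insert.hyps(1) finite_subset by (auto simp: \<B>_def)
    then have "aff_dim (affine hull B) < DIM(real ^ 3)"
      using aff_dim_le_card[of B] that by (simp add: \<B>_def)
    then obtain a b where "a \<noteq> 0" "affine hull B \<subseteq> {x. a \<bullet> x = b}"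
      by (rule aff_lowdim_subset_hyperplane)
    then show ?thesis using negligible_hyperplane[of a b] negligible_subset by blast
  qed
  then have "negligible (\<Union>((hull) affine ` \<B>))"
    using fin by (intro negligible_Union) auto
  then have "\<not> ball (q i) \<delta> \<subseteq> \<Union>((hull) affine ` \<B>)"
    using open_not_negligible[OF open_ball, of "q i" \<delta>] negligible_subset assms(2) centre_in_ball
    by blast
  then obtain x where x: "dist (q i) x < \<delta>" "\<And>B. B \<in> \<B> \<Longrightarrow> x \<notin> affine hull B"
    unfolding subset_iff mem_ball by blast
  have xI: "x \<notin> p ` I"
  proof
    assume "x \<in> p ` I"
    then have "{x} \<in> \<B>" by (simp add: \<B>_def)
    then show False using x(2)[of "{x}"] by simp
  qed
  define p' where "p' = p(i := x)"
  have im: "p' ` insert i I = insert x (p ` I)" "p' ` I = p ` I"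
    using insert.hyps(2) by (auto simp: p'_def)
  have "\<not> affine_dependent B" if B: "B \<subseteq> insert x (p ` I)" "card B \<le> 4" for B
  proof (cases "x \<in> B")
    case False
    with B have "B \<subseteq> p ` I" by blast
    with B p(3) show ?thesis by (simp add: general_position_def)
  next
    case True
    have fB: "finite B" using B(1) insert.hyps(1) finite_subset by blast
    have sub: "B - {x} \<subseteq> p ` I" using B(1) by blast
    have c: "card (B - {x}) \<le> 3" using True B(2) fB by simp
    have "\<not> affine_dependent (B - {x})" using sub c p(3) by (simp add: general_position_def)
    moreover have "x \<notin> affine hull (B - {x})" using sub c x(2) by (simp add: \<B>_def)
    ultimately have "\<not> affine_dependent (insert x (B - {x}))" by (rule affine_independent_insert)
    then show ?thesis using True by (simp add: insert_absorb)
  qed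
  then have "general_position (p' ` insert i I)"
    using insert.hyps(1) unfolding im general_position_def by blast
  moreover have "inj_on p' (insert i I)"
    using p(2) xI insert.hyps(2) im(2) by (auto simp: p'_def inj_on_def)
  moreover have "\<forall>j\<in>insert i I. dist (q j) (p' j) < \<delta>" using p(1) x(1) by (auto simp: p'_def)
  ultimately show ?case by blast
qed

text \<open>Separating \<open>p\<close> from the hull of the other points gives a linear functional
  that is maximal at \<open>p\<close>; it is divided by its largest entry in absolute value.\<close>

lemma convex_position_normal:
  assumes S: "finite S" "convex_position S" "p \<in> S"
  obtains v :: "real ^ 3" and t where "\<bar>v $ t\<bar> = 1" "\<And>i. \<bar>v $ i\<bar> \<le> 1" "\<And>q. q \<in> S \<Longrightarrow> v \<bullet> q \<le> v \<bullet> p"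
proof -
  have "\<exists>a. a \<noteq> 0 \<and> (\<forall>q\<in>S. a \<bullet> q \<le> a \<bullet> p)"
  proof (cases "S = {p}")
    \<comment> \<open>Separation from an empty hull would not force a nonzero normal, so some vector
      is fixed here.\<close>
    case True
    then show ?thesis by (intro exI[of _ "axis 1 1"]) (auto simp: axis_eq_0_iff)
  next
    case False
    let ?K = "convex hull (S - {p})"
    have "closed ?K" using S(1) by (intro compact_imp_closed compact_convex_hull finite_imp_compact) auto
    then obtain a b where ab: "a \<bullet> p < b" "\<And>x. x \<in> ?K \<Longrightarrow> b < a \<bullet> x"
      using separating_hyperplane_closed_point[of ?K p] S(2,3) by (auto simp: convex_position_def)
    have le: "a \<bullet> p \<le> a \<bullet> q" if "q \<in> S" for q
      using ab(1) ab(2)[of q] that hull_inc[of q "S - {p}" convex] by (cases "q = p") auto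
    obtain q where "q \<in> S - {p}" using False S(3) by blast
    then have "a \<noteq> 0" using ab(1) ab(2)[of q] hull_inc[of q "S - {p}" convex] by auto
    then show ?thesis using le by (intro exI[of _ "- a"]) auto
  qed
  then obtain a where a: "a \<noteq> 0" "\<And>q. q \<in> S \<Longrightarrow> a \<bullet> q \<le> a \<bullet> p" by blast
  define M where "M = Max (range (\<lambda>i. \<bar>a $ i\<bar>))"
  have le: "\<bar>a $ i\<bar> \<le> M" for i unfolding M_def by (intro Max_ge) auto
  have "M \<in> range (\<lambda>i. \<bar>a $ i\<bar>)" unfolding M_def by (intro Max_in) auto
  then obtain t where t: "\<bar>a $ t\<bar> = M" by auto
  obtain i where "a $ i \<noteq> 0" using a(1) by (auto simp: vec_eq_iff)
  then have M: "0 < M" using le[of i] by linarith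
  show ?thesis
  proof (rule that[of "(1 / M) *\<^sub>R a" t])
    show "\<bar>((1 / M) *\<^sub>R a) $ t\<bar> = 1" using t M by (simp add: abs_mult)
    show "\<bar>((1 / M) *\<^sub>R a) $ i\<bar> \<le> 1" for i using le[of i] M by (simp add: abs_mult)
    show "((1 / M) *\<^sub>R a) \<bullet> q \<le> ((1 / M) *\<^sub>R a) \<bullet> p" if "q \<in> S" for q
      using a(2)[OF that] M by (simp add: divide_right_mono)
  qed
qed

text \<open>\<open>f\<close> is the lower envelope of the supporting affine functions. Above the
  base point of \<open>q\<close> the function belonging to \<open>q\<close> takes the value
  \<open>z q\<close>, and no other one is smaller there.\<close>

lemma exists_sep_concave_through:
  fixes x y z :: "'a \<Rightarrow> real"
  assumes fin: "finite B" "B \<noteq> {}"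
    and supp: "\<And>p. p \<in> B \<Longrightarrow> \<exists>\<alpha> \<beta>. \<bar>\<alpha>\<bar> \<le> 1 \<and> \<bar>\<beta>\<bar> \<le> 1 \<and>
      (\<forall>q\<in>B. z q \<le> z p + \<alpha> * (x q - x p) + \<beta> * (y q - y p))"
  obtains f where "sep_concave 1 f" "\<And>q. q \<in> B \<Longrightarrow> f (x q) (y q) = z q"
proof -
  obtain \<alpha> \<beta> where ab: "\<And>p. p \<in> B \<Longrightarrow> \<bar>\<alpha> p\<bar> \<le> 1" "\<And>p. p \<in> B \<Longrightarrow> \<bar>\<beta> p\<bar> \<le> 1"
      "\<And>p q. p \<in> B \<Longrightarrow> q \<in> B \<Longrightarrow> z q \<le> z p + \<alpha> p * (x q - x p) + \<beta> p * (y q - y p)"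
    using supp by metis
  define A where "A p u v = z p + \<alpha> p * (u - x p) + \<beta> p * (v - y p)" for p u v
  define f where "f u v = Min ((\<lambda>p. A p u v) ` B)" for u v
  have le: "f u v \<le> A p u v" if "p \<in> B" for p u v unfolding f_def using fin that by (intro Min_le) auto
  have att: "\<exists>p\<in>B. f u v = A p u v" for u v
  proof -
    have "f u v \<in> (\<lambda>p. A p u v) ` B" unfolding f_def using fin by (intro Min_in) auto
    then show ?thesis by blast
  qed
  have lip: "f u v \<le> f u' v' + (\<bar>u - u'\<bar> + \<bar>v - v'\<bar>)" for u v u' v'
  proof -
    obtain p where p: "p \<in> B" "f u' v' = A p u' v'" using att by blast
    have "f u v \<le> A p u v" using le p by blast
    also have "\<dots> = A p u' v' + (\<alpha> p * (u - u') + \<beta> p * (v - v'))" by (simp add: A_def algebra_simps)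
    also have "\<alpha> p * (u - u') + \<beta> p * (v - v') \<le> \<bar>\<alpha> p\<bar> * \<bar>u - u'\<bar> + \<bar>\<beta> p\<bar> * \<bar>v - v'\<bar>"
      unfolding abs_mult[symmetric] by (intro add_mono abs_ge_self)
    also have "\<dots> \<le> \<bar>u - u'\<bar> + \<bar>v - v'\<bar>" using ab p by (intro add_mono mult_left_le_one_le) auto
    finally show ?thesis using p by simp
  qed
  have conc: "concave_on UNIV (\<lambda>u. f u v)" for v
    unfolding concave_on_iff
  proof (intro conjI ballI allI impI convex_UNIV)
    fix a b s t :: real assume st: "0 \<le> s" "0 \<le> t" "s + t = 1"
    obtain p where p: "p \<in> B" "f (s *\<^sub>R a + t *\<^sub>R b) v = A p (s *\<^sub>R a + t *\<^sub>R b) v" using att by blast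
    have "s * f a v + t * f b v \<le> s * A p a v + t * A p b v"
      using st p le by (intro add_mono mult_left_mono) auto
    also have "\<dots> = A p (s *\<^sub>R a + t *\<^sub>R b) v"
    proof -
      have t: "t = 1 - s" using st(3) by simp
      show ?thesis unfolding A_def t by (simp add: algebra_simps)
    qed
    finally show "s * f a v + t * f b v \<le> f (s *\<^sub>R a + t *\<^sub>R b) v" using p by simp
  qed
  have conc2: "concave_on UNIV (f u)" for u
    unfolding concave_on_iff
  proof (intro conjI ballI allI impI convex_UNIV)
    fix a b s t :: real assume st: "0 \<le> s" "0 \<le> t" "s + t = 1"
    obtain p where p: "p \<in> B" "f u (s *\<^sub>R a + t *\<^sub>R b) = A p u (s *\<^sub>R a + t *\<^sub>R b)" using att by blast
    have "s * f u a + t * f u b \<le> s * A p u a + t * A p u b"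
      using st p le by (intro add_mono mult_left_mono) auto
    also have "\<dots> = A p u (s *\<^sub>R a + t *\<^sub>R b)"
    proof -
      have t: "t = 1 - s" using st(3) by simp
      show ?thesis unfolding A_def t by (simp add: algebra_simps)
    qed
    finally show "s * f u a + t * f u b \<le> f u (s *\<^sub>R a + t *\<^sub>R b)" using p by simp
  qed
  show ?thesis
  proof (rule that[of f])
    have "\<bar>f u v - f u' v'\<bar> \<le> \<bar>u - u'\<bar> + \<bar>v - v'\<bar>" for u v u' v'
      using lip[of u v u' v'] lip[of u' v' u v] by linarith
    from this[of _ v _ v for v] this[of u _ u for u] show "sep_concave 1 f"
      using conc conc2 unfolding sep_concave_def by auto
    fix q assume q: "q \<in> B"
    obtain p where p: "p \<in> B" "f (x q) (y q) = A p (x q) (y q)" using att by blast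
    then have "z q \<le> f (x q) (y q)" using ab(3) q by (simp add: A_def)
    moreover have "f (x q) (y q) \<le> z q" using le[OF q, of "x q" "y q"] by (simp add: A_def)
    ultimately show "f (x q) (y q) = z q" by simp
  qed
qed

subsection \<open>Lattice points near graphs\<close>

lemma card_int_near_le:
  fixes e v r :: real
  assumes e: "0 < e" and r: "0 \<le> r"
  shows "finite {z::int. \<bar>real_of_int z / e - v\<bar> \<le> r}"
    and "real (card {z::int. \<bar>real_of_int z / e - v\<bar> \<le> r}) \<le> 2 * e * r + 1"
proof -
  let ?I = "{\<lceil>e * (v - r)\<rceil>..\<lfloor>e * (v + r)\<rfloor>}"
  have sub: "{z::int. \<bar>real_of_int z / e - v\<bar> \<le> r} \<subseteq> ?I"
    using e by (auto simp: abs_le_iff field_simps ceiling_le_iff le_floor_iff)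
  then show "finite {z::int. \<bar>real_of_int z / e - v\<bar> \<le> r}" by (rule finite_subset) simp
  have "card {z::int. \<bar>real_of_int z / e - v\<bar> \<le> r} \<le> card ?I" by (rule card_mono[OF _ sub]) simp
  then have "real (card {z::int. \<bar>real_of_int z / e - v\<bar> \<le> r}) \<le> real (nat (\<lfloor>e * (v + r)\<rfloor> - \<lceil>e * (v - r)\<rceil> + 1))"
    by (simp add: algebra_simps)
  also have "\<dots> \<le> 2 * e * r + 1"
  proof -
    have "real_of_int (\<lfloor>e * (v + r)\<rfloor> - \<lceil>e * (v - r)\<rceil> + 1) \<le> e * (v + r) - e * (v - r) + 1"
      by linarith
    also have "\<dots> = 2 * e * r + 1" by (simp add: algebra_simps)
    finally show ?thesis using e r by (cases "\<lfloor>e * (v + r)\<rfloor> - \<lceil>e * (v - r)\<rceil> + 1 \<ge> 0") auto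
  qed
  finally show "real (card {z::int. \<bar>real_of_int z / e - v\<bar> \<le> r}) \<le> 2 * e * r + 1" .
qed

lemma sum_div_eq:
  fixes h :: "nat \<Rightarrow> 'a::comm_semiring_1"
  shows "(\<Sum>x<m * H. h (x div H)) = of_nat H * (\<Sum>i<m. h i)"
proof -
  have "(\<Sum>x<m * H. h (x div H)) = (\<Sum>i<m. \<Sum>x=i * H..<i * H + H. h (x div H))"
    by (rule sum.nat_group[symmetric])
  also have "\<dots> = (\<Sum>i<m. \<Sum>x=i * H..<i * H + H. h i)"
    by (intro sum.cong refl arg_cong[of _ _ h] div_nat_eqI) (auto simp: mult.commute)
  also have "\<dots> = of_nat H * (\<Sum>i<m. h i)" by (simp add: sum_distrib_left)
  finally show ?thesis .
qed

text \<open>A unit square has \<open>H\<close> lattice steps per side, a unit of height has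
  \<open>e\<close>. The shift by 1 numbers the squares from 1, which leaves grid points on both
  sides for second differences. In 26, one unit is the distance to the graph of the original
  function and 25 comes from \<open>sep_concave_close\<close>.\<close>

definition near_graph :: "nat \<Rightarrow> nat \<Rightarrow> (real \<Rightarrow> real \<Rightarrow> real) \<Rightarrow> nat \<Rightarrow> nat \<Rightarrow> int \<Rightarrow> bool" where
  "near_graph H e g x y z \<longleftrightarrow> \<bar>real_of_int z / real e - g (real x / real H + 1) (real y / real H + 1)\<bar>
     \<le> 26 + gap g (real (x div H + 1)) (real (y div H + 1))"

text \<open>Counted along vertical lines: each carries at most \<open>e * (53 + 2 * gap)\<close>
  points. The gap is at most 12 on average, and \<open>53 + 24 = 77\<close>.\<close>

lemma card_near_graph_le:
  assumes g: "sep_concave (real m) g" and e: "1 \<le> e"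
  shows "finite {(x, y, z). x < m * H \<and> y < m * H \<and> near_graph H e g x y z}"
    and "real (card {(x, y, z). x < m * H \<and> y < m * H \<and> near_graph H e g x y z}) \<le> 77 * real e * (real (m * H))\<^sup>2"
proof -
  let ?Z = "\<lambda>x y. {z. near_graph H e g x y z}"
  let ?c = "\<lambda>i j. real e * (53 + 2 * gap g (real (i + 1)) (real (j + 1)))"
  have eq: "{(x, y, z). x < m * H \<and> y < m * H \<and> near_graph H e g x y z}
     = (SIGMA x:{..<m * H}. SIGMA y:{..<m * H}. ?Z x y)" by auto
  have finZ: "finite (?Z x y)" for x y
    unfolding near_graph_def using e gap_nonneg[OF g] by (intro card_int_near_le) auto
  have cardZ: "real (card (?Z x y)) \<le> ?c (x div H) (y div H)" for x y
  proof -
    let ?r = "26 + gap g (real (x div H + 1)) (real (y div H + 1))"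
    have "real (card (?Z x y)) \<le> 2 * real e * ?r + 1"
      unfolding near_graph_def using e gap_nonneg[OF g] by (intro card_int_near_le) auto
    also have "\<dots> \<le> 2 * real e * ?r + real e" using e by simp
    finally show ?thesis by (simp add: algebra_simps)
  qed
  show "finite {(x, y, z). x < m * H \<and> y < m * H \<and> near_graph H e g x y z}"
    unfolding eq using finZ by (intro finite_SigmaI) auto
  have "real (card {(x, y, z). x < m * H \<and> y < m * H \<and> near_graph H e g x y z})
      = (\<Sum>x<m * H. \<Sum>y<m * H. real (card (?Z x y)))"
    unfolding eq using finZ by (subst card_SigmaI) (auto simp: card_SigmaI)
  also have "\<dots> \<le> (\<Sum>x<m * H. \<Sum>y<m * H. ?c (x div H) (y div H))"
    by (intro sum_mono cardZ)
  also have "\<dots> = (\<Sum>x<m * H. real H * (\<Sum>j<m. ?c (x div H) j))"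
    by (intro sum.cong refl sum_div_eq)
  also have "\<dots> = real H * (\<Sum>i<m. real H * (\<Sum>j<m. ?c i j))"
    by (rule sum_div_eq[of "\<lambda>i. real H * (\<Sum>j<m. ?c i j)"])
  also have "\<dots> = (real H)\<^sup>2 * (\<Sum>i<m. \<Sum>j<m. ?c i j)"
    by (simp add: sum_distrib_left power2_eq_square mult.assoc)
  also have "\<dots> \<le> (real H)\<^sup>2 * (77 * real e * (real m)\<^sup>2)"
  proof (rule mult_left_mono)
    have "(\<Sum>i<m. \<Sum>j<m. ?c i j)
        = real e * (53 * (real m)\<^sup>2 + 2 * (\<Sum>i=1..m. \<Sum>j=1..m. gap g (real i) (real j)))"
      by (simp add: sum.atLeast1_atMost_eq sum.distrib sum_distrib_left power2_eq_square distrib_left ac_simps)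
    also have "\<dots> \<le> real e * (53 * (real m)\<^sup>2 + 2 * (12 * real m * real m))"
      by (intro mult_left_mono add_left_mono sum_gap_le[OF g]) auto
    also have "\<dots> = 77 * real e * (real m)\<^sup>2" by (simp add: power2_eq_square)
    finally show "(\<Sum>i<m. \<Sum>j<m. ?c i j) \<le> 77 * real e * (real m)\<^sup>2" .
  qed simp
  also have "\<dots> = 77 * real e * (real (m * H))\<^sup>2" by (simp add: power_mult_distrib)
  finally show "real (card {(x, y, z). x < m * H \<and> y < m * H \<and> near_graph H e g x y z}) \<le> 77 * real e * (real (m * H))\<^sup>2" .
qed

text \<open>Used with side \<open>N\<close> for the cells and with side \<open>m^2\<close> for the
  offsets within a cell.\<close>

definition lattice_cube :: "nat \<Rightarrow> (3 \<Rightarrow> nat) set" where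
  "lattice_cube k = PiE UNIV (\<lambda>_. {..<k})"

text \<open>Offsets use only half of the cell of side \<open>2 * M\<close>; this keeps points of different cells apart.\<close>
definition coord :: "nat \<Rightarrow> (3 \<Rightarrow> nat) \<Rightarrow> (3 \<Rightarrow> nat) \<Rightarrow> 3 \<Rightarrow> nat" where
  "coord M c d i = 2 * M * c i + d i"

lemma mem_lattice_cube: "c \<in> lattice_cube k \<longleftrightarrow> (\<forall>i. c i < k)"
  by (auto simp: lattice_cube_def)

lemma finite_lattice_cube: "finite (lattice_cube k)"
  by (simp add: lattice_cube_def finite_PiE)

lemma card_lattice_cube: "card (lattice_cube k) = k ^ 3"
  by (simp add: lattice_cube_def card_PiE)

lemma coord_less:
  assumes "c \<in> lattice_cube N" "d \<in> lattice_cube M"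
  shows "coord M c d i < 2 * M * N"
proof -
  have "c i + 1 \<le> N" "d i < M" using assms by (auto simp: mem_lattice_cube Suc_le_eq)
  then have "2 * M * c i + d i < 2 * M * (c i + 1)" by simp
  also have "\<dots> \<le> 2 * M * N" using \<open>c i + 1 \<le> N\<close> by (rule mult_le_mono2)
  finally show ?thesis by (simp add: coord_def)
qed

lemma coord_inj:
  assumes "d \<in> lattice_cube M" "d' \<in> lattice_cube M" "\<And>i. coord M c d i = coord M c' d' i"
  shows "c = c'" "d = d'"
proof -
  have "c i = c' i \<and> d i = d' i" for i
  proof -
    have lt: "d i < 2 * M" "d' i < 2 * M" using assms(1,2) by (auto simp: mem_lattice_cube intro: less_le_trans)
    have "(2 * M * c i + d i) div (2 * M) = (2 * M * c' i + d' i) div (2 * M)"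
      "(2 * M * c i + d i) mod (2 * M) = (2 * M * c' i + d' i) mod (2 * M)"
      using assms(3)[of i] by (simp_all add: coord_def)
    then show ?thesis using lt by (simp del: mult.assoc)
  qed
  then show "c = c'" "d = d'" by auto
qed

text \<open>A tuple \<open>(u, w, t, s)\<close> describes graphs over the \<open>(u, w)\<close>-plane in the direction of axis \<open>t\<close> with sign \<open>s\<close>.\<close>
definition dirs :: "(3 \<times> 3 \<times> 3 \<times> int) set" where
  "dirs = {(2,3,1,1), (2,3,1,-1), (1,3,2,1), (1,3,2,-1), (1,2,3,1), (1,2,3,-1)}"

lemma finite_dirs: "finite dirs"
  by (simp add: dirs_def)

lemma card_dirs_le: "card dirs \<le> 6"
  unfolding dirs_def by (intro card_insert_le_m1 | simp)+

lemma dirs_UNIV: "(u, w, t, s) \<in> dirs \<Longrightarrow> UNIV = {u, w, t} \<and> distinct [u, w, t] \<and> (s = 1 \<or> s = -1)"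
  unfolding dirs_def UNIV_3 by auto

lemma exp_of_nat_le_power: "exp (real k) \<le> 2 ^ (2 * k)"
proof -
  have "exp (real k) = exp 1 ^ k" by (simp add: exp_of_nat_mult[symmetric])
  also have "\<dots> \<le> (2\<^sup>2) ^ k" using exp_le by (intro power_mono) auto
  finally show ?thesis by (simp only: power_mult)
qed

text \<open>A union bound over the net and the directions, with one set \<open>R\<close> of pairs of
  cell and offset for each. It covers all \<open>f\<close> at once, because the points near
  \<open>f\<close> are also near the graph of a net element in the sense of
  \<open>near_graph\<close>.\<close>

lemma exists_choice_few_near_graph:
  fixes m N :: nat
  assumes m: "1 \<le> m" and N: "1 \<le> N" "N ^ 3 \<le> 8 * m ^ 4" and C: "C \<subseteq> lattice_cube N"
  obtains d where "\<And>c. c \<in> C \<Longrightarrow> d c \<in> lattice_cube (m\<^sup>2)"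
    "\<And>f u w t s. sep_concave (real m) f \<Longrightarrow> \<bar>f 0 0\<bar> \<le> 8 * (real m)\<^sup>2 \<Longrightarrow> (u, w, t, s) \<in> dirs \<Longrightarrow>
      card {c \<in> C. \<bar>real_of_int (s * int (coord (m\<^sup>2) c (d c) t)) / real (2 * N)
         - f (real (coord (m\<^sup>2) c (d c) u) / real (2 * m * N) + 1)
             (real (coord (m\<^sup>2) c (d c) w) / real (2 * m * N) + 1)\<bar> \<le> 1} < 10000 * m\<^sup>2"
proof -
  let ?M = "m\<^sup>2" and ?H = "2 * m * N" and ?e = "2 * N"
  obtain G where G: "finite G" "card G \<le> 2 ^ (63 * m\<^sup>2)" "\<And>g. g \<in> G \<Longrightarrow> sep_concave (real m) g"
    "\<And>f. sep_concave (real m) f \<Longrightarrow> \<bar>f 0 0\<bar> \<le> 8 * (real m)\<^sup>2 \<Longrightarrow>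
      \<exists>g\<in>G. \<forall>a\<le>m+1. \<forall>b\<le>m+1. \<bar>f (real a) (real b) - g (real a) (real b)\<bar> \<le> 1"
    using sep_concave_net[OF m] by blast
  define R where "R = (\<lambda>((u, w, t, s), g). {(c, d).
    near_graph ?H ?e g (coord ?M c d u) (coord ?M c d w) (s * int (coord ?M c d t))})"
  have mH: "m * ?H = 2 * ?M * N" by (simp add: power2_eq_square)
  have finC: "finite C" using C finite_lattice_cube finite_subset by blast
  have small: "real (card (R x \<inter> C \<times> lattice_cube ?M)) \<le> real (4928 * m\<^sup>2) * real (card (lattice_cube ?M))"
    if "x \<in> dirs \<times> G" for x
  proof -
    obtain D g where Dg: "x = (D, g)" by (cases x)
    obtain u w t s where D: "D = (u, w, t, s)" by (cases D)
    have x: "x = ((u, w, t, s), g)" "(u, w, t, s) \<in> dirs" "g \<in> G" using that Dg D by auto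
    have U: "i = u \<or> i = w \<or> i = t" for i using dirs_UNIV[OF x(2)] by auto
    have s: "s = 1 \<or> s = -1" using dirs_UNIV[OF x(2)] by auto
    \<comment> \<open>Distinct candidates are distinct lattice points, so the count of lattice
      points near a graph bounds the count of pairs of cell and offset.\<close>
    let ?f = "\<lambda>(c, d). (coord ?M c d u, coord ?M c d w, s * int (coord ?M c d t))"
    let ?T = "{(x, y, z). x < m * ?H \<and> y < m * ?H \<and> near_graph ?H ?e g x y z}"
    have fT: "finite ?T" and cT: "real (card ?T) \<le> 77 * real ?e * (real (m * ?H))\<^sup>2"
      using card_near_graph_le[OF G(3)[OF x(3)], of ?e ?H] N by auto
    have "inj_on ?f (R x \<inter> C \<times> lattice_cube ?M)"
    proof (rule inj_onI, clarify)
      fix c d c' d'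
      assume d: "d \<in> lattice_cube ?M" "d' \<in> lattice_cube ?M"
        and eq: "coord ?M c d u = coord ?M c' d' u" "coord ?M c d w = coord ?M c' d' w"
          "s * int (coord ?M c d t) = s * int (coord ?M c' d' t)"
      have "coord ?M c d t = coord ?M c' d' t" using eq(3) s by auto
      then have "coord ?M c d i = coord ?M c' d' i" for i using U[of i] eq(1,2) by auto
      then show "c = c' \<and> d = d'" using coord_inj[OF d] by blast
    qed
    moreover have "?f ` (R x \<inter> C \<times> lattice_cube ?M) \<subseteq> ?T"
      using C coord_less[of _ N _ ?M] unfolding mH by (auto simp: R_def x)
    ultimately have "card (R x \<inter> C \<times> lattice_cube ?M) \<le> card ?T" using fT by (rule card_inj_on_le)
    then have "real (card (R x \<inter> C \<times> lattice_cube ?M)) \<le> 77 * real ?e * (real (m * ?H))\<^sup>2" using cT by linarith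
    \<comment> \<open>Here \<open>616 = 77 * 2 * 4\<close>. The bound on \<open>N ^ 3\<close>
      contributes a further factor 8, and there are \<open>m ^ 6\<close> offsets to divide
      by.\<close>
    also have "\<dots> = 616 * (real m ^ 4 * real (N ^ 3))" unfolding mH by (simp add: power2_eq_square eval_nat_numeral)
    also have "\<dots> \<le> 616 * (real m ^ 4 * real (8 * m ^ 4))"
      using of_nat_mono[OF N(2), where ?'a = real] by (intro mult_left_mono) simp_all
    also have "\<dots> = real (4928 * m\<^sup>2) * real (card (lattice_cube ?M))"
      by (simp add: card_lattice_cube flip: power_mult power_add)
    finally show ?thesis .
  qed
  have "card (dirs \<times> G) \<le> 8 * 2 ^ (63 * m\<^sup>2)"
    unfolding card_cartesian_product using card_dirs_le by (intro mult_mono G(2)) auto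
  from of_nat_mono[OF this, where ?'a = real]
  have cd: "real (card (dirs \<times> G)) \<le> 8 * 2 ^ (63 * m\<^sup>2)" by simp
  have fd: "finite (dirs \<times> G)" using G(1) finite_dirs by simp
  \<comment> \<open>With \<open>exp 1\<close> bounded by 4, the exponent of 2 is at most
    \<open>(9856 + 63) * m^2 + 3\<close>, where 3 accounts for the directions.\<close>
  have few: "real (card (R ` (dirs \<times> G))) * exp (real (4928 * m\<^sup>2)) < 2 ^ (10000 * m\<^sup>2)"
  proof -
    have "real (card (R ` (dirs \<times> G))) \<le> real (card (dirs \<times> G))" using card_image_le[OF fd] by simp
    also note cd
    also have "8 * 2 ^ (63 * m\<^sup>2) = (2::real) ^ (3 + 63 * m\<^sup>2)" by (simp add: power_add)
    finally have 1: "real (card (R ` (dirs \<times> G))) \<le> 2 ^ (3 + 63 * m\<^sup>2)" .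
    have "real (card (R ` (dirs \<times> G))) * exp (real (4928 * m\<^sup>2)) \<le> 2 ^ (3 + 63 * m\<^sup>2) * 2 ^ (2 * (4928 * m\<^sup>2))"
      by (intro mult_mono 1 exp_of_nat_le_power) auto
    also have "\<dots> = 2 ^ (3 + 63 * m\<^sup>2 + 2 * (4928 * m\<^sup>2))" by (rule power_add[symmetric])
    also have "\<dots> < (2::real) ^ (10000 * m\<^sup>2)"
    proof (rule power_strict_increasing)
      have "1 \<le> m\<^sup>2" using m by simp
      then show "3 + 63 * m\<^sup>2 + 2 * (4928 * m\<^sup>2) < 10000 * m\<^sup>2" by linarith
    qed simp
    finally show ?thesis .
  qed
  have ne: "lattice_cube ?M \<noteq> {}" using card_lattice_cube[of ?M] m by (metis card.empty power_not_zero not_one_le_zero)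
  have sm: "real (card (R' \<inter> C \<times> lattice_cube ?M)) \<le> real (4928 * m\<^sup>2) * real (card (lattice_cube ?M))"
    if "R' \<in> R ` (dirs \<times> G)" for R' using that small by auto
  obtain d where d: "\<And>c. c \<in> C \<Longrightarrow> d c \<in> lattice_cube ?M"
      "\<And>R'. R' \<in> R ` (dirs \<times> G) \<Longrightarrow> card {c \<in> C. (c, d c) \<in> R'} < 10000 * m\<^sup>2"
    using exists_choice_avoiding[OF finC finite_lattice_cube ne finite_imageI[OF fd] sm few] by blast
  show ?thesis
  proof (rule that[of d])
    show "d c \<in> lattice_cube ?M" if "c \<in> C" for c using d(1) that .
    fix f u w t s
    assume f: "sep_concave (real m) f" "\<bar>f 0 0\<bar> \<le> 8 * (real m)\<^sup>2" and D: "(u, w, t, s) \<in> dirs"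
    obtain g where g: "g \<in> G" "\<And>a b. a \<le> m+1 \<Longrightarrow> b \<le> m+1 \<Longrightarrow> \<bar>f (real a) (real b) - g (real a) (real b)\<bar> \<le> 1"
      using G(4)[OF f] by blast
    let ?x = "\<lambda>c. coord ?M c (d c) u" and ?y = "\<lambda>c. coord ?M c (d c) w" and ?z = "\<lambda>c. s * int (coord ?M c (d c) t)"
    let ?S = "{c \<in> C. \<bar>real_of_int (?z c) / real ?e - f (real (?x c) / real ?H + 1) (real (?y c) / real ?H + 1)\<bar> \<le> 1}"
    have H: "0 < ?H" using m N by simp
    \<comment> \<open>A scaled coordinate is the index of its square plus a position
      \<open>r\<close> within the square.\<close>
    have split: "\<exists>r. real x / real ?H + 1 = real (x div ?H + 1) + r \<and> 0 \<le> r \<and> r \<le> 1 \<and> 1 \<le> x div ?H + 1 \<and> x div ?H + 1 \<le> m"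
      if "x < m * ?H" for x
    proof (intro exI conjI)
      show "real x / real ?H + 1 = real (x div ?H + 1) + real (x mod ?H) / real ?H"
      proof -
        have "real x = real (x div ?H) * real ?H + real (x mod ?H)"
          by (simp only: of_nat_mult[symmetric] of_nat_add[symmetric] div_mult_mod_eq)
        then have "real x / real ?H = (real (x div ?H) * real ?H + real (x mod ?H)) / real ?H" by simp
        also have "\<dots> = real (x div ?H) + real (x mod ?H) / real ?H"
          using H by (subst add_divide_distrib) simp
        finally show ?thesis by simp
      qed
      show "real (x mod ?H) / real ?H \<le> 1" using H by (simp add: divide_le_eq_1 less_imp_le mod_less_divisor del: of_nat_mult)
      show "x div ?H + 1 \<le> m" using that H by (simp add: Suc_le_eq less_mult_imp_div_less)
    qed auto
    \<comment> \<open>Replacing \<open>f\<close> by \<open>g\<close> adds at most 25 plus the gap of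
      \<open>g\<close> to the distance 1.\<close>
    have "?S \<subseteq> {c \<in> C. (c, d c) \<in> R ((u, w, t, s), g)}"
    proof (clarify)
      fix c assume c: "c \<in> C" and n: "\<bar>real_of_int (?z c) / real ?e - f (real (?x c) / real ?H + 1) (real (?y c) / real ?H + 1)\<bar> \<le> 1"
      have "?x c < m * ?H" "?y c < m * ?H" unfolding mH using c C d(1) by (auto intro: coord_less)
      then obtain r r' where r: "real (?x c) / real ?H + 1 = real (?x c div ?H + 1) + r" "0 \<le> r" "r \<le> 1" "1 \<le> ?x c div ?H + 1" "?x c div ?H + 1 \<le> m"
        and r': "real (?y c) / real ?H + 1 = real (?y c div ?H + 1) + r'" "0 \<le> r'" "r' \<le> 1" "1 \<le> ?y c div ?H + 1" "?y c div ?H + 1 \<le> m"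
        using split by metis
      have "\<bar>f (real (?x c div ?H + 1) + r) (real (?y c div ?H + 1) + r') - g (real (?x c div ?H + 1) + r) (real (?y c div ?H + 1) + r')\<bar>
          \<le> 25 + gap g (real (?x c div ?H + 1)) (real (?y c div ?H + 1))"
        by (rule sep_concave_close[OF f(1) G(3)[OF g(1)] g(2) r(4,5) r'(4,5) r(2,3) r'(2,3)])
      then have "near_graph ?H ?e g (?x c) (?y c) (?z c)"
        using n unfolding near_graph_def r(1) r'(1) by linarith
      then show "(c, d c) \<in> R ((u, w, t, s), g)" by (simp add: R_def)
    qed
    then have "card ?S \<le> card {c \<in> C. (c, d c) \<in> R ((u, w, t, s), g)}" using finC by (intro card_mono) auto
    also have "\<dots> < 10000 * m\<^sup>2" using D g(1) by (intro d(2)) auto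
    finally show "card ?S < 10000 * m\<^sup>2" .
  qed
qed

subsection \<open>Sets in convex position\<close>

text \<open>The scaling matches \<open>near_graph\<close>. For \<open>L = 1\<close>,
  \<open>H = 2 * m * N\<close> and \<open>e = 2 * N\<close> the new Lipschitz constant is
  \<open>m\<close>.\<close>

lemma sep_concave_rescale:
  assumes f: "sep_concave L f" and H: "0 < H" and e: "0 < e"
  shows "sep_concave (L * H / e) (\<lambda>a b. f (H * (a - 1)) (H * (b - 1)) / e)"
proof -
  have aff: "concave_on UNIV (\<lambda>a. h (H * (a - 1)) / e)" if h: "concave_on UNIV h" for h :: "real \<Rightarrow> real"
    unfolding concave_on_iff
  proof (intro conjI ballI allI impI convex_UNIV)
    fix a b s t :: real assume st: "0 \<le> s" "0 \<le> t" "s + t = 1"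
    have "s * h (H * (a - 1)) + t * h (H * (b - 1)) \<le> h (s *\<^sub>R (H * (a - 1)) + t *\<^sub>R (H * (b - 1)))"
      using h st unfolding concave_on_iff by blast
    also have "s *\<^sub>R (H * (a - 1)) + t *\<^sub>R (H * (b - 1)) = H * (s *\<^sub>R a + t *\<^sub>R b - 1)"
    proof -
      have t: "t = 1 - s" using st(3) by simp
      show ?thesis unfolding t by (simp add: algebra_simps)
    qed
    finally show "s * (h (H * (a - 1)) / e) + t * (h (H * (b - 1)) / e) \<le> h (H * (s *\<^sub>R a + t *\<^sub>R b - 1)) / e"
      using e by (simp add: divide_right_mono flip: add_divide_distrib)
  qed
  have lip: "\<bar>u / e - v / e\<bar> \<le> L * H / e * \<bar>a - b\<bar>" if "\<bar>u - v\<bar> \<le> L * \<bar>H * (a - 1) - H * (b - 1)\<bar>" for u v a b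
  proof -
    have "\<bar>u / e - v / e\<bar> = \<bar>u - v\<bar> / e" using e by (simp flip: diff_divide_distrib)
    also have "\<dots> \<le> L * \<bar>H * (a - 1) - H * (b - 1)\<bar> / e" using that e by (intro divide_right_mono) auto
    also have "\<bar>H * (a - 1) - H * (b - 1)\<bar> = H * \<bar>a - b\<bar>"
      using H by (simp add: abs_mult flip: right_diff_distrib)
    finally show ?thesis by simp
  qed
  show ?thesis
    using f unfolding sep_concave_def by (intro conjI allI aff lip) simp_all
qed

lemma general_position_subset: "general_position A \<Longrightarrow> B \<subseteq> A \<Longrightarrow> general_position B"
  unfolding general_position_def by (meson finite_subset order_trans)

lemma spread_le:
  assumes A: "finite A" and d: "0 < d" "0 \<le> D"
    and dist: "\<And>x y. x \<in> A \<Longrightarrow> y \<in> A \<Longrightarrow> x \<noteq> y \<Longrightarrow> d \<le> dist x y \<and> dist x y \<le> D"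
  shows "spread A \<le> D / d"
proof (cases "card A < 2")
  case True
  then show ?thesis using d by (simp add: spread_def)
next
  case False
  have "pairwise_dists A \<subseteq> (\<lambda>(x, y). dist x y) ` (A \<times> A)" by (auto simp: pairwise_dists_def)
  then have fin: "finite (pairwise_dists A)" using A by (meson finite_SigmaI finite_imageI finite_subset)
  have "\<not> is_singleton A" "A \<noteq> {}" using False by (auto simp: is_singleton_altdef)
  then have ne: "pairwise_dists A \<noteq> {}"
    unfolding pairwise_dists_def by (auto simp: is_singleton_def)
  have "Max (pairwise_dists A) \<le> D" "d \<le> Min (pairwise_dists A)"
    using fin ne dist by (auto simp: pairwise_dists_def)
  then show ?thesis using d False by (simp add: spread_def frac_le)
qed

lemma dirs_cover:
  fixes v :: "real ^ 3"
  assumes "\<bar>v $ t\<bar> = 1"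
  obtains u w s where "(u, w, t, s) \<in> dirs" "v $ t = real_of_int s"
proof -
  have "v $ t = 1 \<or> v $ t = -1" using assms by linarith
  moreover have "t = 1 \<or> t = 2 \<or> t = 3" by (rule exhaust_3)
  ultimately show ?thesis using that unfolding dirs_def by fastforce
qed

lemma inner_dirs:
  fixes v q :: "real ^ 3"
  assumes "(u, w, t, s) \<in> dirs"
  shows "v \<bullet> q = v $ u * q $ u + v $ w * q $ w + v $ t * q $ t"
proof -
  have U: "UNIV = {u, w, t}" "distinct [u, w, t]" using dirs_UNIV[OF assms] by auto
  have "v \<bullet> q = (\<Sum>i\<in>{u, w, t}. v $ i * q $ i)" unfolding inner_vec_def U(1)[symmetric] by simp
  also have "\<dots> = v $ u * q $ u + v $ w * q $ w + v $ t * q $ t" using U(2) by simp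
  finally show ?thesis .
qed

text \<open>The big cube has side \<open>2 * m^2 * N\<close>, which is \<open>m\<close> unit squares
  of \<open>2 * m * N\<close> lattice steps each.\<close>

lemma exists_dense_without_large_convex:
  fixes n m N :: nat
  assumes m: "1 \<le> m" and N: "1 \<le> N" "n \<le> N ^ 3" "N ^ 3 \<le> 8 * m ^ 4"
  shows "\<exists>A. finite A \<and> card A = n \<and> general_position A \<and> spread A \<le> 12 * real N \<and>
    (\<forall>S\<subseteq>A. convex_position S \<longrightarrow> card S \<le> 60000 * m\<^sup>2)"
proof -
  let ?M = "m\<^sup>2" and ?H = "2 * m * N" and ?e = "2 * N"
  let ?L = "2 * ?M * N"
  define q where "q = (\<lambda>(c, d). (\<chi> i. real (coord ?M c d i)) :: real ^ 3)"
  obtain C where C: "C \<subseteq> lattice_cube N" "card C = n"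
    using N(2) card_lattice_cube[of N] obtain_subset_with_card_n by metis
  have finC: "finite C" using C(1) finite_lattice_cube finite_subset by blast
  obtain d where d: "\<And>c. c \<in> C \<Longrightarrow> d c \<in> lattice_cube ?M"
    "\<And>f u w t s. sep_concave (real m) f \<Longrightarrow> \<bar>f 0 0\<bar> \<le> 8 * (real m)\<^sup>2 \<Longrightarrow> (u, w, t, s) \<in> dirs \<Longrightarrow>
      card {c \<in> C. \<bar>real_of_int (s * int (coord ?M c (d c) t)) / real ?e
         - f (real (coord ?M c (d c) u) / real ?H + 1)
             (real (coord ?M c (d c) w) / real ?H + 1)\<bar> \<le> 1} < 10000 * m\<^sup>2"
    using exists_choice_few_near_graph[OF m N(1,3) C(1)] by blast
  \<comment> \<open>Displacements below 1/4 keep points of different cells \<open>m^2\<close> apart,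
    and change the vertical distance to a 1-Lipschitz graph by at most 3/4.\<close>
  obtain p where p: "\<And>i. i \<in> lattice_cube N \<times> lattice_cube ?M \<Longrightarrow> dist (q i) (p i) < 1 / 4"
      "inj_on p (lattice_cube N \<times> lattice_cube ?M)" "general_position (p ` (lattice_cube N \<times> lattice_cube ?M))"
    using exists_near_general_position[of "lattice_cube N \<times> lattice_cube ?M" "1/4" q] finite_lattice_cube by auto
  define X where "X c = coord ?M c (d c)" for c
  define P where "P c = p (c, d c)" for c
  have mem: "(c, d c) \<in> lattice_cube N \<times> lattice_cube ?M" if "c \<in> C" for c using that C(1) d(1) by auto
  have near: "\<bar>P c $ i - real (X c i)\<bar> \<le> 1 / 4" if "c \<in> C" for c i
  proof -
    have "\<bar>(P c - q (c, d c)) $ i\<bar> \<le> norm (P c - q (c, d c))" by (rule component_le_norm_cart)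
    also have "\<dots> \<le> 1 / 4" using p(1)[OF mem[OF that]] by (simp add: P_def dist_norm norm_minus_commute)
    finally show ?thesis by (simp add: q_def X_def)
  qed
  have injP: "inj_on P C" using p(2) mem unfolding P_def inj_on_def by blast
  have XL: "X c i < ?L" if "c \<in> C" for c i
    unfolding X_def using that C(1) d(1) by (intro coord_less) auto
  have PL: "- 1 / 4 \<le> P c $ i" "P c $ i \<le> real ?L" if "c \<in> C" for c i
  proof -
    have "real (X c i) + 1 \<le> real ?L" using XL[OF that, of i] by linarith
    then show "- 1 / 4 \<le> P c $ i" "P c $ i \<le> real ?L" using near[OF that, of i] by linarith+
  qed
  have "0 < ?L" using m N(1) by simp
  then have L1: "1 \<le> real ?L" by linarith
  define A where "A = P ` C"
  have A: "finite A" "card A = n" using finC injP C(2) by (auto simp: A_def card_image)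
  have gA: "general_position A"
    by (rule general_position_subset[OF p(3)]) (use mem in \<open>auto simp: A_def P_def\<close>)
  have "spread A \<le> (6 * real ?L) / real ?M"
  proof (rule spread_le[OF A(1)])
    fix x y assume "x \<in> A" "y \<in> A" "x \<noteq> y"
    then obtain c c' where c: "c \<in> C" "c' \<in> C" "c \<noteq> c'" "x = P c" "y = P c'" by (auto simp: A_def)
    obtain i where i: "c i \<noteq> c' i" using c(3) by auto
    \<comment> \<open>Offsets fill only the lower half of a cell, so different cell indices force a
      difference of more than \<open>m^2\<close> in that coordinate.\<close>
    have sep: "real (X a i) + real ?M + 1 \<le> real (X b i)" if "a \<in> C" "b \<in> C" "a i < b i" for a b
    proof -
      have "2 * ?M * (a i + 1) \<le> 2 * ?M * b i" using that by (intro mult_le_mono2) auto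
      moreover have "d a i < ?M" using d(1)[OF that(1)] by (simp add: mem_lattice_cube)
      ultimately have "X a i + ?M + 1 \<le> X b i" by (simp add: X_def coord_def)
      then show ?thesis by linarith
    qed
    have "real ?M + 1 \<le> \<bar>real (X c i) - real (X c' i)\<bar>"
      using sep[OF c(1,2)] sep[OF c(2,1)] i by (cases "c i < c' i") auto
    then have "real ?M \<le> \<bar>P c $ i - P c' $ i\<bar>"
      using near[OF c(1), of i] near[OF c(2), of i] by linarith
    also have "\<dots> = \<bar>(x - y) $ i\<bar>" using c(4,5) by simp
    also have "\<dots> \<le> dist x y" unfolding dist_norm by (rule component_le_norm_cart)
    finally have "real ?M \<le> dist x y" .
    moreover have "dist x y \<le> 6 * real ?L"
    proof -
      have "dist x y \<le> (\<Sum>i\<in>UNIV. \<bar>(x - y) $ i\<bar>)" unfolding dist_norm by (rule norm_le_l1_cart)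
      also have "\<dots> \<le> (\<Sum>i\<in>(UNIV::3 set). 2 * real ?L)"
      proof (rule sum_mono)
        fix i
        show "\<bar>(x - y) $ i\<bar> \<le> 2 * real ?L"
          using PL[OF c(1), of i] PL[OF c(2), of i] L1 c(4,5) by (simp add: abs_le_iff)
      qed
      also have "\<dots> = 6 * real ?L" by simp
      finally show ?thesis .
    qed
    ultimately show "real ?M \<le> dist x y \<and> dist x y \<le> 6 * real ?L" ..
  qed (use m in auto)
  also have "\<dots> = 12 * real N" using m by simp
  finally have spr: "spread A \<le> 12 * real N" .
  have "card S \<le> 60000 * m\<^sup>2" if S: "S \<subseteq> A" "convex_position S" for S
  proof -
    obtain C' where C': "C' \<subseteq> C" "S = P ` C'" using S(1) by (auto simp: A_def subset_image_iff)
    have finS: "finite S" using S(1) A(1) finite_subset by blast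
    \<comment> \<open>Points are sorted by the axis \<open>t\<close> and sign \<open>s\<close> of a
      dominant entry of a supporting normal; one point may occur in several classes.\<close>
    define K where "K = (\<lambda>(u::3, w::3, t, s). {c \<in> C'. \<exists>v::real ^ 3. v $ t = real_of_int s \<and> (\<forall>i. \<bar>v $ i\<bar> \<le> 1) \<and>
       (\<forall>q\<in>S. v \<bullet> q \<le> v \<bullet> P c)})"
    have cover: "C' \<subseteq> (\<Union>D\<in>dirs. K D)"
    proof
      fix c assume c: "c \<in> C'"
      then have "P c \<in> S" using C'(2) by blast
      then obtain v t where v: "\<bar>v $ t\<bar> = 1" "\<And>i. \<bar>v $ i\<bar> \<le> 1" "\<And>q. q \<in> S \<Longrightarrow> v \<bullet> q \<le> v \<bullet> P c"
        using convex_position_normal[OF finS S(2)] by metis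
      obtain u w s where "(u, w, t, s) \<in> dirs" "v $ t = real_of_int s" using dirs_cover[OF v(1)] .
      moreover from this have "c \<in> K (u, w, t, s)" using c v unfolding K_def by auto
      ultimately show "c \<in> (\<Union>D\<in>dirs. K D)" by blast
    qed
    have each: "card (K D) \<le> 10000 * m\<^sup>2" if D: "D \<in> dirs" for D
    proof (cases "K D = {}")
      case False
      obtain u w t s where Deq: "D = (u, w, t, s)" by (cases D)
      have dir: "(u, w, t, s) \<in> dirs" using D Deq by simp
      have s: "real_of_int s = 1 \<or> real_of_int s = -1" using dirs_UNIV[OF dir] by auto
      have KC: "K D \<subseteq> C'" by (auto simp: K_def Deq)
      have finK: "finite (K D)" using KC C'(1) finC by (meson finite_subset)
      \<comment> \<open>With \<open>v $ t = s\<close>, the inequality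
        \<open>v \<bullet> q \<le> v \<bullet> P c\<close> is solved for the signed
        \<open>t\<close>-coordinate. The slopes are the other entries of \<open>- v\<close>, so
        their size is at most 1.\<close>
      have supp: "\<exists>\<alpha> \<beta>. \<bar>\<alpha>\<bar> \<le> 1 \<and> \<bar>\<beta>\<bar> \<le> 1 \<and>
          (\<forall>c'\<in>K D. real_of_int s * P c' $ t \<le> real_of_int s * P c $ t + \<alpha> * (P c' $ u - P c $ u) + \<beta> * (P c' $ w - P c $ w))"
        if "c \<in> K D" for c
      proof -
        obtain v where v: "v $ t = real_of_int s" "\<And>i. \<bar>v $ i\<bar> \<le> 1" "\<And>q. q \<in> S \<Longrightarrow> v \<bullet> q \<le> v \<bullet> P c"
          using \<open>c \<in> K D\<close> by (auto simp: K_def Deq)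
        have "real_of_int s * P c' $ t \<le> real_of_int s * P c $ t + (- v $ u) * (P c' $ u - P c $ u) + (- v $ w) * (P c' $ w - P c $ w)"
          if "c' \<in> K D" for c'
        proof -
          have "P c' \<in> S" using that KC C'(2) by blast
          from v(3)[OF this] show ?thesis unfolding inner_dirs[OF dir] v(1) by (simp add: algebra_simps)
        qed
        then show ?thesis using v(2) by (intro exI[of _ "- v $ u"] exI[of _ "- v $ w"]) auto
      qed
      obtain f where f: "sep_concave 1 f" "\<And>c. c \<in> K D \<Longrightarrow> f (P c $ u) (P c $ w) = real_of_int s * P c $ t"
        using exists_sep_concave_through[OF finK False supp] by blast
      define g where "g a b = f (real ?H * (a - 1)) (real ?H * (b - 1)) / real ?e" for a b
      have He: "0 < real ?H" "0 < real ?e" using m N(1) by auto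
      have "1 * real ?H / real ?e = real m" using N(1) by simp
      with sep_concave_rescale[OF f(1) He] have g: "sep_concave (real m) g"
        unfolding g_def by simp
      \<comment> \<open>By the shift, \<open>g 0 0\<close> is the value of \<open>f\<close> at
        \<open>(-H, -H)\<close> divided by \<open>e\<close>. A point of the class differs from that
        place by at most \<open>2 * L\<close> in each coordinate, and \<open>f\<close> is at most
        \<open>L\<close> in size there; \<open>4 * L + L\<close> is rounded up to
        \<open>8 * L = 8 * m^2 * e\<close>.\<close>
      have g0: "\<bar>g 0 0\<bar> \<le> 8 * (real m)\<^sup>2"
      proof -
        obtain c where c: "c \<in> K D" using False by blast
        then have cC: "c \<in> C" using KC C'(1) by blast
        have b: "\<bar>P c $ i\<bar> \<le> real ?L" for i using PL[OF cC, of i] L1 by linarith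
        have "real ?H \<le> real ?L"
          unfolding of_nat_le_iff using m by (simp add: power2_eq_square)
        then have "\<bar>- real ?H - P c $ i\<bar> \<le> 2 * real ?L" for i using b[of i] He(1) by linarith
        from add_mono[OF this[of u] this[of w]]
        have "\<bar>f (- real ?H) (- real ?H) - f (P c $ u) (P c $ w)\<bar> \<le> 2 * real ?L + 2 * real ?L"
          using sep_concave_lipschitz[OF f(1), of "- real ?H" "- real ?H" "P c $ u" "P c $ w"]
          by (simp only: mult_1_left)
        moreover have "\<bar>f (P c $ u) (P c $ w)\<bar> \<le> real ?L"
          unfolding f(2)[OF c] using s b[of t] by auto
        ultimately have "\<bar>f (- real ?H) (- real ?H)\<bar> \<le> 8 * real ?L" by linarith
        also have "8 * real ?L = 8 * (real m)\<^sup>2 * real ?e" by simp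
        finally show ?thesis using He by (simp add: g_def pos_divide_le_eq)
      qed
      have "K D \<subseteq> {c \<in> C. \<bar>real_of_int (s * int (coord ?M c (d c) t)) / real ?e
         - g (real (coord ?M c (d c) u) / real ?H + 1) (real (coord ?M c (d c) w) / real ?H + 1)\<bar> \<le> 1}"
      proof (rule subsetI, rule CollectI, rule conjI)
        fix c assume c: "c \<in> K D"
        then show cC: "c \<in> C" using KC C'(1) by blast
        have near': "\<bar>real (X c i) - P c $ i\<bar> \<le> 1 / 4" for i
          using near[OF cC, of i] by (simp only: abs_minus_commute)
        have "\<bar>f (real (X c u)) (real (X c w)) - f (P c $ u) (P c $ w)\<bar> \<le> 1 / 4 + 1 / 4"
          using sep_concave_lipschitz[OF f(1), of "real (X c u)" "real (X c w)" "P c $ u" "P c $ w"]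
            add_mono[OF near'[of u] near'[of w]] by (simp only: mult_1_left)
        moreover have "\<bar>real_of_int s * real (X c t) - real_of_int s * P c $ t\<bar> \<le> 1 / 4"
          using near[OF cC, of t] near'[of t] s by (elim disjE) simp_all
        \<comment> \<open>The error is 1/2 from the two horizontal coordinates and 1/4 from the
          height.\<close>
        ultimately have "\<bar>real_of_int s * real (X c t) - f (real (X c u)) (real (X c w))\<bar> \<le> 1"
          unfolding f(2)[OF c] by linarith
        also have "1 \<le> real ?e" using N(1) by simp
        finally have "\<bar>(real_of_int s * real (X c t) - f (real (X c u)) (real (X c w))) / real ?e\<bar> \<le> 1"
          using He by (simp only: abs_divide abs_of_pos divide_le_eq_1_pos)
        moreover have "g (real (X c u) / real ?H + 1) (real (X c w) / real ?H + 1) = f (real (X c u)) (real (X c w)) / real ?e"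
          using m N(1) by (simp add: g_def)
        ultimately show "\<bar>real_of_int (s * int (coord ?M c (d c) t)) / real ?e
         - g (real (coord ?M c (d c) u) / real ?H + 1) (real (coord ?M c (d c) w) / real ?H + 1)\<bar> \<le> 1"
          unfolding X_def[symmetric] by (simp only: diff_divide_distrib of_int_mult of_int_of_nat_eq)
      qed
      then have "card (K D) \<le> card {c \<in> C. \<bar>real_of_int (s * int (coord ?M c (d c) t)) / real ?e
         - g (real (coord ?M c (d c) u) / real ?H + 1) (real (coord ?M c (d c) w) / real ?H + 1)\<bar> \<le> 1}"
        using finC by (intro card_mono) auto
      also have "\<dots> < 10000 * m\<^sup>2" by (rule d(2)[OF g g0 dir])
      finally show ?thesis by simp
    qed simp
    have finU: "finite (\<Union>D\<in>dirs. K D)"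
    proof (rule finite_subset)
      show "(\<Union>D\<in>dirs. K D) \<subseteq> C" using C'(1) by (auto simp: K_def)
    qed (rule finC)
    have "card S \<le> card C'" unfolding C'(2) using C'(1) finC by (intro card_image_le) (rule finite_subset)
    also have "\<dots> \<le> card (\<Union>D\<in>dirs. K D)" by (rule card_mono[OF finU cover])
    also have "\<dots> \<le> (\<Sum>D\<in>dirs. card (K D))" by (rule card_UN_le[OF finite_dirs])
    also have "\<dots> \<le> (\<Sum>D\<in>dirs. 10000 * m\<^sup>2)" by (intro sum_mono each)
    also have "\<dots> \<le> 6 * (10000 * m\<^sup>2)" using card_dirs_le by simp
    finally show ?thesis by simp
  qed
  then show ?thesis using A gA spr by blast
qed

section \<open>Choice of the parameters\<close>

lemma ceiling_root:
  fixes n k :: nat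
  assumes n: "1 \<le> n" and k: "1 \<le> k"
  defines "r \<equiv> nat \<lceil>real n powr (1 / real k)\<rceil>"
  shows "1 \<le> r" "n \<le> r ^ k" "real r \<le> 2 * real n powr (1 / real k)"
proof -
  let ?x = "real n powr (1 / real k)"
  have x: "1 \<le> ?x" using n by (simp add: ge_one_powr_ge_zero)
  have r: "?x \<le> real r" "real r \<le> ?x + 1" using x unfolding r_def by linarith+
  show "1 \<le> r" using x r by linarith
  show "real r \<le> 2 * ?x" using x r by linarith
  have "real n = ?x ^ k" using n k by (simp add: powr_realpow[symmetric] powr_powr)
  also have "\<dots> \<le> real r ^ k" using r x by (intro power_mono) auto
  finally show "n \<le> r ^ k" by (simp flip: of_nat_power)
qed

theorem theorem6:
  shows "\<exists>\<alpha>>0. \<exists>K>0. \<forall>n::nat. \<exists>A :: (real ^ 3) set.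
    finite A \<and> card A = n \<and> general_position A \<and>
    spread A \<le> \<alpha> * real n powr (1 / 3) \<and>
    (\<forall>S\<subseteq>A. convex_position S \<longrightarrow> real (card S) \<le> K * real n powr (1 / 2))"
\<comment> \<open>Rounding a root of \<open>n \<ge> 1\<close> up at most doubles it, so
  \<open>24 = 12 * 2\<close> and \<open>240000 = 60000 * 2^2\<close>.\<close>
proof (rule exI[of _ 24], rule conjI[rotated], rule exI[of _ 240000], rule conjI[rotated], rule allI)
  fix n :: nat
  show "\<exists>A :: (real ^ 3) set. finite A \<and> card A = n \<and> general_position A \<and>
    spread A \<le> 24 * real n powr (1 / 3) \<and>
    (\<forall>S\<subseteq>A. convex_position S \<longrightarrow> real (card S) \<le> 240000 * real n powr (1 / 2))"
  proof (cases "n = 0")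
    case True
    \<comment> \<open>Both bounds are 0 here, since \<open>0 powr a = 0\<close>; the spread of the
      empty set is 0 by convention.\<close>
    then show ?thesis
      by (intro exI[of _ "{}"]) (auto simp: general_position_def spread_def affine_dependent_def)
  next
    case False
    then have n: "1 \<le> n" by simp
    \<comment> \<open>\<open>N\<close> is about \<open>n^(1/3)\<close> for the spread, and
      \<open>m\<close> about \<open>n^(1/4)\<close>, so that \<open>m^2\<close> is about
      \<open>n^(1/2)\<close>. Rounding up gives \<open>N ^ 3 \<le> 8 * n\<close> and
      \<open>n \<le> m ^ 4\<close>, which links the two parameters.\<close>
    define N where "N = nat \<lceil>real n powr (1 / real 3)\<rceil>"
    define m where "m = nat \<lceil>real n powr (1 / real 4)\<rceil>"
    note N = ceiling_root[OF n, of 3, folded N_def, simplified]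
    note m = ceiling_root[OF n, of 4, folded m_def, simplified]
    have "real N ^ 3 \<le> (2 * real n powr (1 / 3)) ^ 3" using N(3) by (intro power_mono) auto
    also have "\<dots> = 8 * real n" using n by (simp add: power_mult_distrib powr_realpow[symmetric] powr_powr)
    finally have "N ^ 3 \<le> 8 * n" by (simp flip: of_nat_power)
    also have "\<dots> \<le> 8 * m ^ 4" using m(2) by simp
    finally have Nm: "N ^ 3 \<le> 8 * m ^ 4" .
    have "(real m)\<^sup>2 \<le> (2 * real n powr (1 / 4))\<^sup>2" using m(3) by (intro power_mono) auto
    also have "\<dots> = 4 * real n powr (1 / 2)"
      using n by (simp add: power_mult_distrib powr_realpow[symmetric] powr_powr)
    finally have m2: "(real m)\<^sup>2 \<le> 4 * real n powr (1 / 2)" .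
    have "1 \<le> m" "1 \<le> N" using m(1) N(1) by simp_all
    from exists_dense_without_large_convex[OF this N(2) Nm]
    obtain A where A: "finite A" "card A = n" "general_position A" "spread A \<le> 12 * real N"
      "\<And>S. S \<subseteq> A \<Longrightarrow> convex_position S \<Longrightarrow> card S \<le> 60000 * m\<^sup>2" by blast
    have "real (card S) \<le> 240000 * real n powr (1 / 2)" if "S \<subseteq> A" "convex_position S" for S
    proof -
      have "real (card S) \<le> real (60000 * m\<^sup>2)" using A(5)[OF that] by (simp only: of_nat_le_iff)
      then show ?thesis using m2 by simp
    qed
    moreover have "spread A \<le> 24 * real n powr (1 / 3)" using A(4) N(3) by linarith
    ultimately show ?thesis using A(1-3) by blast
  qed
qed auto

end
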